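(* Let $\boldsymbol{A}:=(A_1,A_2)$, where for each $j\in\{1,2\}$ the matrix $A_j:=\begin{bmatrix}a_j&b_j\\c_j&d_j\end{bmatrix}$ is a real $2\times2$ matrix with determinant $1$ such that $b_j\neq0$ and $c_j\neq0$, and let $R^{\rm E}_{\rm sc}(A_j):=b_j/c_j$. Let $R_1^{\boldsymbol{A}},R_2^{\boldsymbol{A}}$ be the linear canonical Riesz transforms on $\mathbb{R}^2$ and $R_1,R_2$ the classical Riesz transforms on $\mathbb{R}^2$. Below, $\lim_{\ast}$ denotes the limit as $R^{\rm E}_{\rm sc}(A_j)\to-1$, $a_j\to0$ and $d_j\to0$ for both $j\in\{1,2\}$. Then the following assertions hold. (i) For any $f\in\mathscr{S}(\mathbb{R}^2)$, $\boldsymbol{x}\in\mathbb{R}^2$ and $l\in\{1,2\}$, $$R_l^{\boldsymbol{A}}f(\boldsymbol{x})=\widetilde{c}_2\,e^{-i\sum_{j=1}^2\frac{d_jx_j^2}{2R^{\rm E}_{\rm sc}(A_j)c_j}}\ \mathrm{p.v.}\int_{\mathbb{R}^2}\frac{(x_l-y_l)\,f(\boldsymbol{y})\,e^{i\sum_{j=1}^2\frac{a_jy_j^2}{2R^{\rm E}_{\rm sc}(A_j)c_j}}}{|\boldsymbol{x}-\boldsymbol{y}|^3}\,d\boldsymbol{y}.$$ (ii) For any $f\in\mathscr{S}(\mathbb{R}^2)$ and $\boldsymbol{x}\in\mathbb{R}^2$, $$\lim_{\ast}R_1^{\boldsymbol{A}}f(\boldsymbol{x})=R_1f(\boldsymbol{x})\quad\text{and}\quad\lim_{\ast}R_2^{\boldsymbol{A}}f(\boldsymbol{x})=R_2f(\boldsymbol{x}).$$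 (iii) For any $p\in(1,\infty)$ and $f\in L^p(\mathbb{R}^2)$, $$\lim_{\ast}\left\|R_1^{\boldsymbol{A}}f-R_1f\right\|_{L^p(\mathbb{R}^2)}=0\quad\text{and}\quad\lim_{\ast}\left\|R_2^{\boldsymbol{A}}f-R_2f\right\|_{L^p(\mathbb{R}^2)}=0.$$ (iv) For any $p\in(1,\infty)$ and $f\in L^p(\mathbb{R}^2)$, $$\lim_{\ast}R_1^{\boldsymbol{A}}f=R_1f\quad\text{and}\quad\lim_{\ast}R_2^{\boldsymbol{A}}f=R_2f\quad\text{in }\mathscr{S}'(\mathbb{R}^2).$$
   Context: $\mathscr{S}(\mathbb{R}^2)$ is the space of (complex-valued) Schwartz functions on $\mathbb{R}^2$; $\mathscr{S}'(\mathbb{R}^2)$ is the space of tempered distributions with the weak-$\ast$ topology, where $g\in L^p(\mathbb{R}^2)$ acts on $\phi\in\mathscr{S}(\mathbb{R}^2)$ by $\langle g,\phi\rangle=\int_{\mathbb{R}^2}g\phi$. Linear canonical Riesz transforms on $\mathbb{R}^2$. For $\boldsymbol{A}=(A_1,A_2)$ with $A_k=\begin{bmatrix}a_k&b_k\\c_k&d_k\end{bmatrix}$ real of determinant $1$ and $b_k\neq0$, $l\in\{1,2\}$, $f\in\mathscr{S}(\mathbb{R}^2)$ and $\boldsymbol{x}\in\mathbb{R}^2$, $$R_l^{\boldsymbol{A}}f(\boldsymbol{x}):=\widetilde{c}_2\,e^{-i\sum_{k=1}^2\frac{d_k}{2b_k}x_k^2}\ \mathrm{p.v.}\int_{\mathbb{R}^2}\frac{(x_l-y_l)\,f(\boldsymbol{y})\,e^{i\sum_{k=1}^2\frac{a_k}{2b_k}y_k^2}}{|\boldsymbol{x}-\boldsymbol{y}|^{3}}\,d\boldsymbol{y},\qquad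 \widetilde{c}_2:=\frac{\Gamma(3/2)}{\pi^{3/2}},$$ where $\mathrm{p.v.}\int$ denotes $\lim_{\varepsilon\to0^+}\int_{|\boldsymbol{x}-\boldsymbol{y}|\geq\varepsilon}$. The classical Riesz transforms are $R_lf(\boldsymbol{x}):=\widetilde{c}_2\ \mathrm{p.v.}\int_{\mathbb{R}^2}\frac{(x_l-y_l)f(\boldsymbol{y})}{|\boldsymbol{x}-\boldsymbol{y}|^3}\,d\boldsymbol{y}$. For $p\in(1,\infty)$ and $f\in L^p(\mathbb{R}^2)$, $R_l^{\boldsymbol{A}}f$ and $R_lf$ denote the values of the unique bounded linear extensions of these operators from $\mathscr{S}(\mathbb{R}^2)$ to $L^p(\mathbb{R}^2)$. Sharpness. For a real $2\times2$ matrix $M=\begin{bmatrix}a&b\\c&d\end{bmatrix}$ of determinant $1$ with $c\neq0$, $R^{\rm E}_{\rm sc}(M):=b/c$. Meaning of the limits. $\lim_{\ast}F(\boldsymbol{A})=L$ means: for every neighbourhood $U$ of $L$ there is $\delta>0$ such that $F(\boldsymbol{A})\in U$ for every pair $\boldsymbol{A}=(A_1,A_2)$ of real determinant-$1$ matrices with $b_j\neq0$, $c_j\neq0$, $|R^{\rm E}_{\rm sc}(A_j)+1|<\delta$, $|a_j|<\delta$ and $|d_j|<\delta$ for $j\in\{1,2\}$. *)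

theory Defs
  imports "HOL-Analysis.Analysis"
begin

section \<open>Schwartz functions and tempered distributions on the plane\<close>

definition partial_deriv :: "2 \<Rightarrow> (real^2 \<Rightarrow> complex) \<Rightarrow> real^2 \<Rightarrow> complex" where
  "partial_deriv j f x = frechet_derivative f (at x) (axis j 1)"

text \<open>Iterated partial derivatives are indexed by lists of directions.  Where every iterated partial
  derivative is differentiable, the order of the directions is immaterial, so that the lists
  give exactly the derivatives indexed by multi-indices.\<close>

fun partial_derivs :: "2 list \<Rightarrow> (real^2 \<Rightarrow> complex) \<Rightarrow> real^2 \<Rightarrow> complex" where
  "partial_derivs [] f = f"
| "partial_derivs (j # js) f = partial_deriv j (partial_derivs js f)"

definition weighted_deriv ::
    "(2 \<Rightarrow> nat) \<Rightarrow> 2 list \<Rightarrow> (real^2 \<Rightarrow> complex) \<Rightarrow> real^2 \<Rightarrow> real" where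
  "weighted_deriv \<alpha> js f x = norm (complex_of_real (\<Prod>j\<in>UNIV. (x $ j) ^ \<alpha> j) * partial_derivs js f x)"

definition schwartz_space :: "(real^2 \<Rightarrow> complex) set" where
  "schwartz_space = {f. (\<forall>js x. partial_derivs js f differentiable (at x)) \<and>
                        (\<forall>\<alpha> js. bdd_above (range (weighted_deriv \<alpha> js f)))}"

definition schwartz_seminorm :: "(2 \<Rightarrow> nat) \<Rightarrow> 2 list \<Rightarrow> (real^2 \<Rightarrow> complex) \<Rightarrow> real" where
  "schwartz_seminorm \<alpha> js f = (SUP x. weighted_deriv \<alpha> js f x)"

definition schwartz_topology :: "(real^2 \<Rightarrow> complex) topology" where
  "schwartz_topology = topology_generated_by
     {{g \<in> schwartz_space. schwartz_seminorm \<alpha> js (\<lambda>x. g x - f x) < \<epsilon>} | \<alpha> js f \<epsilon>.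
        f \<in> schwartz_space \<and> 0 < \<epsilon>}"

text \<open>A functional on the Schwartz space is encoded as a function that takes the value
  \<^const>\<open>undefined\<close> outside that space, so that equality of functionals is equality in HOL.\<close>

definition tempered_distributions :: "((real^2 \<Rightarrow> complex) \<Rightarrow> complex) set" where
  "tempered_distributions = {u \<in> extensional schwartz_space.
     (\<forall>\<phi>\<in>schwartz_space. \<forall>\<psi>\<in>schwartz_space. u (\<lambda>x. \<phi> x + \<psi> x) = u \<phi> + u \<psi>) \<and>
     (\<forall>c. \<forall>\<phi>\<in>schwartz_space. u (\<lambda>x. c * \<phi> x) = c * u \<phi>) \<and>
     continuous_map schwartz_topology euclidean u}"

text \<open>The topology of pointwise convergence on Schwartz functions, that is, the weak-star topology.\<close>

definition tempered_topology :: "((real^2 \<Rightarrow> complex) \<Rightarrow> complex) topology" where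
  "tempered_topology =
     subtopology (product_topology (\<lambda>_. euclidean) schwartz_space) tempered_distributions"

definition distribution_of :: "(real^2 \<Rightarrow> complex) \<Rightarrow> (real^2 \<Rightarrow> complex) \<Rightarrow> complex" where
  "distribution_of g = (\<lambda>\<phi>\<in>schwartz_space. LINT x|lebesgue. g x * \<phi> x)"

section \<open>Lebesgue spaces and extension of operators\<close>

text \<open>Elements of Lebesgue spaces are represented by functions; statements about them are invariant
  under changes on null sets.\<close>

definition Lp_space :: "real \<Rightarrow> (real^2 \<Rightarrow> complex) set" where
  "Lp_space p = {f \<in> borel_measurable lebesgue. integrable lebesgue (\<lambda>x. norm (f x) powr p)}"

definition Lp_norm :: "real \<Rightarrow> (real^2 \<Rightarrow> complex) \<Rightarrow> real" where
  "Lp_norm p f = (LINT x|lebesgue. norm (f x) powr p) powr (1 / p)"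

definition is_bounded_Lp_extension ::
    "real \<Rightarrow> ((real^2 \<Rightarrow> complex) \<Rightarrow> real^2 \<Rightarrow> complex) \<Rightarrow>
     ((real^2 \<Rightarrow> complex) \<Rightarrow> real^2 \<Rightarrow> complex) \<Rightarrow> bool" where
  "is_bounded_Lp_extension p T T' \<longleftrightarrow>
     (\<forall>f\<in>Lp_space p. T' f \<in> Lp_space p) \<and>
     (\<forall>f\<in>Lp_space p. \<forall>g\<in>Lp_space p.
        AE x in lebesgue. T' (\<lambda>y. f y + g y) x = T' f x + T' g x) \<and>
     (\<forall>c. \<forall>f\<in>Lp_space p. AE x in lebesgue. T' (\<lambda>y. c * f y) x = c * T' f x) \<and>
     (\<exists>C. \<forall>f\<in>Lp_space p. Lp_norm p (T' f) \<le> C * Lp_norm p f) \<and>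
     (\<forall>\<phi>\<in>schwartz_space. AE x in lebesgue. T' \<phi> x = T \<phi> x)"

text \<open>By density of Schwartz functions, a bounded extension is unique up to null sets if
  \<open>1 \<le> p\<close>; the choice below is merely one of representatives.  For the Riesz transforms and
  \<open>1 < p\<close> it exists by Calderon--Zygmund theory.  The value \<open>0\<close> is the convention for
  operators without a bounded extension.\<close>

definition Lp_extension ::
    "real \<Rightarrow> ((real^2 \<Rightarrow> complex) \<Rightarrow> real^2 \<Rightarrow> complex) \<Rightarrow>
     (real^2 \<Rightarrow> complex) \<Rightarrow> real^2 \<Rightarrow> complex" where
  "Lp_extension p T =
     (if \<exists>T'. is_bounded_Lp_extension p T T' then (SOME T'. is_bounded_Lp_extension p T T')
      else (\<lambda>_ _. 0))"

section \<open>Riesz transforms\<close>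

definition pv_integral :: "real^2 \<Rightarrow> (real^2 \<Rightarrow> complex) \<Rightarrow> complex" where
  "pv_integral x h = Lim (at_right 0) (\<lambda>\<epsilon>. LINT y:{y. \<epsilon> \<le> norm (x - y)}|lebesgue. h y)"

definition riesz_const :: real where
  "riesz_const = Gamma (3 / 2) / pi powr (3 / 2)"

definition riesz :: "2 \<Rightarrow> (real^2 \<Rightarrow> complex) \<Rightarrow> real^2 \<Rightarrow> complex" where
  "riesz l f x = of_real riesz_const *
     pv_integral x (\<lambda>y. of_real (x $ l - y $ l) * f y / of_real (norm (x - y) ^ 3))"

text \<open>For a matrix \<open>M\<close> with rows \<open>(a, b)\<close> and \<open>(c, d)\<close> we have \<open>a = M $ 1 $ 1\<close>,
  \<open>b = M $ 1 $ 2\<close>, \<open>c = M $ 2 $ 1\<close> and \<open>d = M $ 2 $ 2\<close>.\<close>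

definition lc_riesz ::
    "(2 \<Rightarrow> real^2^2) \<Rightarrow> 2 \<Rightarrow> (real^2 \<Rightarrow> complex) \<Rightarrow> real^2 \<Rightarrow> complex" where
  "lc_riesz A l f x = of_real riesz_const *
     exp (- \<i> * of_real (\<Sum>k\<in>UNIV. A k $ 2 $ 2 / (2 * A k $ 1 $ 2) * (x $ k)\<^sup>2)) *
     pv_integral x (\<lambda>y. of_real (x $ l - y $ l) * f y *
       exp (\<i> * of_real (\<Sum>k\<in>UNIV. A k $ 1 $ 1 / (2 * A k $ 1 $ 2) * (y $ k)\<^sup>2)) /
       of_real (norm (x - y) ^ 3))"

definition sharpness :: "real^2^2 \<Rightarrow> real" where
  "sharpness M = M $ 1 $ 2 / M $ 2 $ 1"

definition admissible :: "(2 \<Rightarrow> real^2^2) \<Rightarrow> bool" where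
  "admissible A \<longleftrightarrow> (\<forall>j. det (A j) = 1 \<and> A j $ 1 $ 2 \<noteq> 0 \<and> A j $ 2 $ 1 \<noteq> 0)"

definition sharp_nbhd :: "real \<Rightarrow> (2 \<Rightarrow> real^2^2) set" where
  "sharp_nbhd \<delta> = {A. admissible A \<and>
     (\<forall>j. \<bar>sharpness (A j) + 1\<bar> < \<delta> \<and> \<bar>A j $ 1 $ 1\<bar> < \<delta> \<and> \<bar>A j $ 2 $ 2\<bar> < \<delta>)}"

definition sharp_filter :: "(2 \<Rightarrow> real^2^2) filter" where
  "sharp_filter = (INF \<delta>\<in>{0<..}. principal (sharp_nbhd \<delta>))"

lemma eventually_sharp_filter:
  "eventually P sharp_filter \<longleftrightarrow> (\<exists>\<delta>>0. \<forall>A\<in>sharp_nbhd \<delta>. P A)"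
proof -
  have "eventually P sharp_filter \<longleftrightarrow>
      (\<exists>\<delta>\<in>{0<..}. eventually P (principal (sharp_nbhd \<delta>)))"
    unfolding sharp_filter_def
  proof (rule eventually_INF_base)
    show "{0<..} \<noteq> ({} :: real set)"
      by (rule greaterThan_non_empty)
    fix a b :: real
    assume "a \<in> {0<..}" "b \<in> {0<..}"
    then show "\<exists>x\<in>{0<..}. principal (sharp_nbhd x) \<le>
        inf (principal (sharp_nbhd a)) (principal (sharp_nbhd b))"
      by (intro bexI[of _ "min a b"]) (auto simp: sharp_nbhd_def)
  qed
  then show ?thesis
    by (auto simp: eventually_principal)
qed

lemma sharp_filter_neq_bot: "sharp_filter \<noteq> bot"
proof -
  define J :: "2 \<Rightarrow> real^2^2" where
    "J = (\<lambda>_. vector [vector [0, 1], vector [-1, 0]])"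
  have "J \<in> sharp_nbhd \<delta>" if "\<delta> > 0" for \<delta>
    using that by (simp add: sharp_nbhd_def admissible_def sharpness_def det_2 J_def)
  then show ?thesis
    unfolding trivial_limit_def eventually_sharp_filter by blast
qed

end

theory Submission
  imports Defs
begin

text \<open>
  Write \<open>chirp s\<close> for the unimodular function \<open>x \<mapsto> exp (\<i> (s\<^sub>1 x\<^sub>1\<^sup>2 + s\<^sub>2 x\<^sub>2\<^sup>2))\<close>.  Directly from the definitions,
  the linear canonical Riesz transform is the classical one conjugated by chirps
  (\<open>lc_riesz_eq_chirp_riesz\<close>): multiply by the chirp with parameters \<open>a\<^sub>k / (2 b\<^sub>k)\<close>, apply the Riesz
  transform, and multiply by the chirp with parameters \<open>- d\<^sub>k / (2 b\<^sub>k)\<close>.  The determinant condition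
  gives \<open>b\<^sub>k\<^sup>2 = (b\<^sub>k / c\<^sub>k) (a\<^sub>k d\<^sub>k - 1)\<close>, which tends to \<open>1\<close> in the limit considered.  Hence \<open>\<bar>b\<^sub>k\<bar>\<close> tends
  to \<open>1\<close> and both chirp parameters tend to \<open>0\<close>, so everything reduces to continuity in the chirp
  parameter at \<open>0\<close>.

  Pointwise limit.  The kernel \<open>z\<^sub>l / \<bar>z\<bar>\<^sup>3\<close> is odd, so the principal value is the absolutely convergent
  integral of half the kernel times \<open>h (x - z) - h (x + z)\<close> (\<open>riesz_eq_symmetrized_integral\<close>).
  For \<open>h = chirp s * f\<close> with \<open>\<bar>s\<bar> \<le> 1\<close> the difference is at most a constant times \<open>\<bar>z\<bar>\<close> near the
  origin and decays at infinity, uniformly in \<open>s\<close>, so dominated convergence applies.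

  Limit in the norm.  Multiplication by a chirp is an isometry of every Lebesgue space and maps the
  Schwartz space to itself.  Therefore the two transforms either both have bounded extensions or
  neither has one.  In the second case both extensions are \<open>0\<close> by convention.  In the first case
  the conjugation identity passes to the extensions, because Schwartz functions are dense
  (\<open>Lp_space_schwartz_induct\<close>) and bounded extensions are thus unique; with \<open>T\<close> the extended Riesz
  transform, \<open>u\<close> the input chirp and \<open>v\<close> the output chirp,
  \<open>v T (u f) - T f = v T ((u - 1) f) + (v - 1) T f\<close>,
  and both terms tend to \<open>0\<close> in norm by boundedness of \<open>T\<close> and dominated convergence
  (\<open>Lp_extension_lc_riesz_tendsto_powr\<close>).

  Limit of distributions.  A Schwartz function is bounded by a multiple of the integrable weight
  \<open>1 / ((1 + x\<^sub>1\<^sup>2) (1 + x\<^sub>2\<^sup>2))\<close>, and the elementary bound \<open>norm_mult_weight_le\<close> plays the part of the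
  Hoelder inequality: norm convergence forces the integrals of the differences against this weight
  to vanish.
\<close>

section \<open>Schwartz functions and chirps\<close>

text \<open>The Schwartz condition for a single function: a function belongs to the Schwartz space if and only
  if its iterated partial derivatives are all differentiable and rapidly decreasing in this sense.\<close>

definition rapidly_decreasing :: "(real^2 \<Rightarrow> complex) \<Rightarrow> bool" where
  "rapidly_decreasing f \<longleftrightarrow> (\<forall>\<alpha>. bdd_above (range (weighted_deriv \<alpha> [] f)))"

lemma weighted_deriv_Nil:
  "weighted_deriv \<alpha> [] f x = \<bar>x $ 1\<bar> ^ \<alpha> 1 * \<bar>x $ 2\<bar> ^ \<alpha> 2 * norm (f x)"
  by (simp add: weighted_deriv_def norm_mult norm_power UNIV_2)

lemma rapidly_decreasing_iff:
  "rapidly_decreasing f \<longleftrightarrow> (\<forall>m n. \<exists>C. \<forall>x. \<bar>x $ 1\<bar> ^ m * \<bar>x $ 2\<bar> ^ n * norm (f x) \<le> C)"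
proof
  assume *: "rapidly_decreasing f"
  show "\<forall>m n. \<exists>C. \<forall>x. \<bar>x $ 1\<bar> ^ m * \<bar>x $ 2\<bar> ^ n * norm (f x) \<le> C"
  proof (intro allI)
    fix m n
    have "bdd_above (range (weighted_deriv (\<lambda>j. if j = 1 then m else n) [] f))"
      using * by (auto simp: rapidly_decreasing_def)
    then show "\<exists>C. \<forall>x. \<bar>x $ 1\<bar> ^ m * \<bar>x $ 2\<bar> ^ n * norm (f x) \<le> C"
      by (auto simp: bdd_above_def weighted_deriv_Nil)
  qed
qed (auto simp: rapidly_decreasing_def bdd_above_def weighted_deriv_Nil)

lemma rapidly_decreasing_add:
  assumes "rapidly_decreasing f" "rapidly_decreasing g"
  shows "rapidly_decreasing (\<lambda>x. f x + g x)"
  unfolding rapidly_decreasing_iff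
proof (intro allI)
  fix m n
  obtain C D where C: "\<And>x. \<bar>x $ 1\<bar> ^ m * \<bar>x $ 2\<bar> ^ n * norm (f x) \<le> C"
    and D: "\<And>x. \<bar>x $ 1\<bar> ^ m * \<bar>x $ 2\<bar> ^ n * norm (g x) \<le> D"
    using assms unfolding rapidly_decreasing_iff by meson
  have "\<bar>x $ 1\<bar> ^ m * \<bar>x $ 2\<bar> ^ n * norm (f x + g x) \<le> C + D" for x
  proof -
    have "\<bar>x $ 1\<bar> ^ m * \<bar>x $ 2\<bar> ^ n * norm (f x + g x)
        \<le> \<bar>x $ 1\<bar> ^ m * \<bar>x $ 2\<bar> ^ n * (norm (f x) + norm (g x))"
      by (intro mult_left_mono norm_triangle_ineq) auto
    also have "\<dots> \<le> C + D"
      using C[of x] D[of x] by (simp add: distrib_left)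
    finally show ?thesis .
  qed
  then show "\<exists>C. \<forall>x. \<bar>x $ 1\<bar> ^ m * \<bar>x $ 2\<bar> ^ n * norm (f x + g x) \<le> C"
    by blast
qed

lemma rapidly_decreasing_scale:
  assumes "rapidly_decreasing f" "\<And>x. norm (g x) \<le> K * norm (f x)"
  shows "rapidly_decreasing g"
  unfolding rapidly_decreasing_iff
proof (intro allI)
  fix m n
  obtain C where C: "\<And>x. \<bar>x $ 1\<bar> ^ m * \<bar>x $ 2\<bar> ^ n * norm (f x) \<le> C"
    using assms unfolding rapidly_decreasing_iff by meson
  have "\<bar>x $ 1\<bar> ^ m * \<bar>x $ 2\<bar> ^ n * norm (g x) \<le> \<bar>K\<bar> * C" for x
  proof -
    have "norm (g x) \<le> \<bar>K\<bar> * norm (f x)"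
      using assms(2)[of x] by (meson abs_ge_self mult_right_mono norm_ge_zero order_trans)
    then have "\<bar>x $ 1\<bar> ^ m * \<bar>x $ 2\<bar> ^ n * norm (g x)
        \<le> \<bar>x $ 1\<bar> ^ m * \<bar>x $ 2\<bar> ^ n * (\<bar>K\<bar> * norm (f x))"
      by (intro mult_left_mono) auto
    also have "\<dots> = \<bar>K\<bar> * (\<bar>x $ 1\<bar> ^ m * \<bar>x $ 2\<bar> ^ n * norm (f x))"
      by simp
    also have "\<dots> \<le> \<bar>K\<bar> * C"
      using C[of x] by (intro mult_left_mono) auto
    finally show ?thesis .
  qed
  then show "\<exists>C. \<forall>x. \<bar>x $ 1\<bar> ^ m * \<bar>x $ 2\<bar> ^ n * norm (g x) \<le> C"
    by blast
qed

lemma rapidly_decreasing_coord: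
  assumes "rapidly_decreasing f"
  shows "rapidly_decreasing (\<lambda>x. of_real (x $ j) * f x)"
  unfolding rapidly_decreasing_iff
proof (intro allI)
  fix m n
  have "\<exists>C. \<forall>x. \<bar>x $ 1\<bar> ^ (if j = 1 then Suc m else m) *
      \<bar>x $ 2\<bar> ^ (if j = 1 then n else Suc n) * norm (f x) \<le> C"
    using assms unfolding rapidly_decreasing_iff by blast
  then show "\<exists>C. \<forall>x. \<bar>x $ 1\<bar> ^ m * \<bar>x $ 2\<bar> ^ n * norm (of_real (x $ j) * f x) \<le> C"
    using exhaust_2[of j] by (elim disjE) (simp_all add: norm_mult mult_ac)
qed

lemma partial_deriv_eqI:
  "(f has_derivative f') (at x) \<Longrightarrow> partial_deriv j f x = f' (axis j 1)"
  unfolding partial_deriv_def by (metis frechet_derivative_at)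

lemma partial_deriv_add:
  assumes "\<And>x. f differentiable (at x)" "\<And>x. g differentiable (at x)"
  shows "partial_deriv j (\<lambda>x. f x + g x) = (\<lambda>x. partial_deriv j f x + partial_deriv j g x)"
proof
  fix x
  have "(f has_derivative frechet_derivative f (at x)) (at x)"
    "(g has_derivative frechet_derivative g (at x)) (at x)"
    using assms frechet_derivative_works by blast+
  from has_derivative_add[OF this]
  show "partial_deriv j (\<lambda>x. f x + g x) x = partial_deriv j f x + partial_deriv j g x"
    by (subst partial_deriv_eqI) (auto simp: partial_deriv_def)
qed

lemma partial_deriv_mult:
  assumes "\<And>x. f differentiable (at x)" "\<And>x. g differentiable (at x)"
  shows "partial_deriv j (\<lambda>x. f x * g x) = (\<lambda>x. f x * partial_deriv j g x + partial_deriv j f x * g x)"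
proof
  fix x
  have "(f has_derivative frechet_derivative f (at x)) (at x)"
    "(g has_derivative frechet_derivative g (at x)) (at x)"
    using assms frechet_derivative_works by blast+
  from has_derivative_mult[OF this]
  show "partial_deriv j (\<lambda>x. f x * g x) x = f x * partial_deriv j g x + partial_deriv j f x * g x"
    by (subst partial_deriv_eqI) (auto simp: partial_deriv_def)
qed

lemma has_derivative_coord:
  "((\<lambda>x::real^2. complex_of_real (x $ k)) has_derivative (\<lambda>h. of_real (h $ k))) (at x)"
  by (intro bounded_linear_imp_has_derivative
      bounded_linear_compose[OF bounded_linear_of_real bounded_linear_vec_nth])

lemma differentiable_coord: "(\<lambda>x::real^2. complex_of_real (x $ k)) differentiable (at x)"
  using has_derivative_coord differentiable_def by blast

lemma partial_deriv_coord:
  "partial_deriv j (\<lambda>x. of_real (x $ k)) = (\<lambda>x. if j = k then 1 else 0)"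
  by (intro ext) (simp add: partial_deriv_eqI[OF has_derivative_coord] axis_def)

text \<open>A set closed under partial differentiation whose members are differentiable and decrease rapidly
  consists of Schwartz functions; so the iterated derivatives of a product are handled by finding an
  invariant set that contains it.\<close>

lemma schwartz_space_coinduct:
  assumes "f \<in> B"
    and "\<And>g. g \<in> B \<Longrightarrow> rapidly_decreasing g"
    and "\<And>g x. g \<in> B \<Longrightarrow> g differentiable (at x)"
    and "\<And>g j. g \<in> B \<Longrightarrow> partial_deriv j g \<in> B"
  shows "f \<in> schwartz_space"
proof -
  have B: "partial_derivs js f \<in> B" for js
    by (induction js) (use assms in auto)
  have "weighted_deriv \<alpha> js f = weighted_deriv \<alpha> [] (partial_derivs js f)" for \<alpha> js
    by (rule ext) (simp add: weighted_deriv_def)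
  then show ?thesis
    using B assms(2,3) by (auto simp: schwartz_space_def rapidly_decreasing_def)
qed

lemma schwartz_space_rapidly_decreasing: "f \<in> schwartz_space \<Longrightarrow> rapidly_decreasing f"
  by (auto simp: schwartz_space_def rapidly_decreasing_def)

lemma schwartz_space_differentiable: "f \<in> schwartz_space \<Longrightarrow> f differentiable (at x)"
  unfolding schwartz_space_def by (metis (mono_tags, lifting) mem_Collect_eq partial_derivs.simps(1))

lemma schwartz_space_partial_deriv:
  assumes "f \<in> schwartz_space"
  shows "partial_deriv j f \<in> schwartz_space"
proof -
  have eq: "partial_derivs js (partial_deriv j f) = partial_derivs (js @ [j]) f" for js
    by (induction js) auto
  have "weighted_deriv \<alpha> js (partial_deriv j f) = weighted_deriv \<alpha> (js @ [j]) f" for \<alpha> js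
    by (rule ext) (simp add: weighted_deriv_def eq)
  then show ?thesis
    using assms by (simp add: schwartz_space_def eq)
qed

text \<open>The module generated by \<open>B\<close> over the polynomial functions, presented by single multiplications
  with a coordinate so that induction needs the product rule only for coordinates.\<close>

inductive_set coord_span :: "(real^2 \<Rightarrow> complex) set \<Rightarrow> (real^2 \<Rightarrow> complex) set" for B where
  base: "f \<in> B \<Longrightarrow> f \<in> coord_span B"
| add: "f \<in> coord_span B \<Longrightarrow> g \<in> coord_span B \<Longrightarrow> (\<lambda>x. f x + g x) \<in> coord_span B"
| scale: "f \<in> coord_span B \<Longrightarrow> (\<lambda>x. c * f x) \<in> coord_span B"
| coord: "f \<in> coord_span B \<Longrightarrow> (\<lambda>x. of_real (x $ j) * f x) \<in> coord_span B"

text \<open>Leibniz' rule for a coordinate produces only the coordinate times the derivative and the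
  function itself, so the span inherits closure under differentiation from its generators.\<close>

lemma coord_span_subset_schwartz_space:
  assumes "\<And>g. g \<in> B \<Longrightarrow> rapidly_decreasing g"
    and "\<And>g x. g \<in> B \<Longrightarrow> g differentiable (at x)"
    and "\<And>g j. g \<in> B \<Longrightarrow> partial_deriv j g \<in> coord_span B"
  shows "coord_span B \<subseteq> schwartz_space"
proof
  fix f assume f: "f \<in> coord_span B"
  have main: "rapidly_decreasing g \<and> (\<forall>x. g differentiable (at x)) \<and>
      (\<forall>j. partial_deriv j g \<in> coord_span B)"
    if "g \<in> coord_span B" for g
    using that
  proof induction
    case (base f)
    then show ?case using assms by auto
  next
    case (add f g)
    then show ?case
      by (auto simp: rapidly_decreasing_add partial_deriv_add intro: coord_span.add)
  next
    case (scale f c)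
    have "partial_deriv j (\<lambda>x. c * f x) = (\<lambda>x. c * partial_deriv j f x)" for j
      using scale.IH by (subst partial_deriv_mult) (auto simp: partial_deriv_def)
    moreover have "rapidly_decreasing (\<lambda>x. c * f x)"
      by (rule rapidly_decreasing_scale[of f _ "norm c"]) (use scale in \<open>auto simp: norm_mult\<close>)
    ultimately show ?case
      using scale.IH by (auto intro: coord_span.scale)
  next
    case (coord f k)
    have "partial_deriv j (\<lambda>x. of_real (x $ k) * f x) =
        (\<lambda>x. of_real (x $ k) * partial_deriv j f x + (if j = k then 1 else 0) * f x)" for j
      using coord.IH by (subst partial_deriv_mult) (auto simp: partial_deriv_coord differentiable_coord)
    moreover have "(\<lambda>x. of_real (x $ k) * partial_deriv j f x + (if j = k then 1 else 0) * f x)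
        \<in> coord_span B" for j
      using coord by (intro coord_span.add coord_span.scale coord_span.coord) auto
    ultimately show ?case
      using coord.IH by (simp add: rapidly_decreasing_coord differentiable_coord)
  qed
  show "f \<in> schwartz_space"
    by (rule schwartz_space_coinduct[OF f]) (use main in auto)
qed

text \<open>Taking the Schwartz space itself as the set of generators yields all its algebraic closure
  properties at once.\<close>

lemma coord_span_schwartz_space: "coord_span schwartz_space \<subseteq> schwartz_space"
  by (rule coord_span_subset_schwartz_space)
    (simp_all add: schwartz_space_rapidly_decreasing schwartz_space_differentiable
      schwartz_space_partial_deriv coord_span.base)

lemma
  assumes "f \<in> schwartz_space"
  shows schwartz_space_scale: "(\<lambda>x. c * f x) \<in> schwartz_space"
    and schwartz_space_coord: "(\<lambda>x. of_real (x $ j) * f x) \<in> schwartz_space"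
    and schwartz_space_add: "g \<in> schwartz_space \<Longrightarrow> (\<lambda>x. f x + g x) \<in> schwartz_space"
  using coord_span.scale[OF coord_span.base[OF assms]] coord_span.coord[OF coord_span.base[OF assms]]
    coord_span.add[OF coord_span.base[OF assms] coord_span.base]
  by (auto intro!: subsetD[OF coord_span_schwartz_space])

lemma schwartz_space_diff:
  assumes "f \<in> schwartz_space" "g \<in> schwartz_space"
  shows "(\<lambda>x. f x - g x) \<in> schwartz_space"
  using schwartz_space_add[OF assms(1) schwartz_space_scale[OF assms(2), of "-1"]] by simp

definition chirp :: "real^2 \<Rightarrow> real^2 \<Rightarrow> complex" where
  "chirp s x = exp (\<i> * of_real (\<Sum>k\<in>UNIV. s $ k * (x $ k)\<^sup>2))"

lemma norm_chirp [simp]: "norm (chirp s x) = 1"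
  by (simp add: chirp_def)

lemma chirp_0 [simp]: "chirp 0 x = 1"
  by (simp add: chirp_def)

lemma chirp_uminus_mult [simp]: "chirp (- s) x * chirp s x = 1" "chirp s x * chirp (- s) x = 1"
  by (simp_all add: chirp_def sum_negf flip: exp_add)

lemma has_derivative_chirp:
  "(chirp s has_derivative
     (\<lambda>h. \<i> * of_real (\<Sum>k\<in>UNIV. s $ k * (2 * x $ k * h $ k)) * chirp s x)) (at x)"
proof -
  have eq: "chirp s = (\<lambda>x. exp (\<i> * (of_real (s $ 1) * of_real (x $ 1) ^ 2 +
      of_real (s $ 2) * of_real (x $ 2) ^ 2)))"
    by (simp add: chirp_def sum_2 fun_eq_iff)
  have "((\<lambda>x::real^2. \<i> * (of_real (s $ 1) * of_real (x $ 1) ^ 2 + of_real (s $ 2) * of_real (x $ 2) ^ 2))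
      has_derivative (\<lambda>h. \<i> * of_real (\<Sum>k\<in>UNIV. s $ k * (2 * x $ k * h $ k)))) (at x)"
    by (rule has_derivative_eq_rhs, (rule derivative_intros has_derivative_coord)+)
      (simp add: sum_2 fun_eq_iff algebra_simps)
  from has_derivative_compose[OF this DERIV_exp[unfolded has_field_derivative_def]] show ?thesis
    unfolding eq by (simp add: mult.commute)
qed

lemma partial_deriv_chirp:
  "partial_deriv j (chirp s) = (\<lambda>x. 2 * \<i> * of_real (s $ j) * of_real (x $ j) * chirp s x)"
proof
  fix x
  have "(\<Sum>k\<in>UNIV. s $ k * (2 * x $ k * axis j 1 $ k)) = 2 * s $ j * x $ j"
    using exhaust_2[of j] by (elim disjE) (simp_all add: axis_def sum_2)
  then show "partial_deriv j (chirp s) x = 2 * \<i> * of_real (s $ j) * of_real (x $ j) * chirp s x"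
    by (simp add: partial_deriv_eqI[OF has_derivative_chirp])
qed

text \<open>The derivative of \<open>chirp s * f\<close> is again a chirp times a Schwartz function, as the derivative of
  the phase is linear; so the set of all such products is an invariant set.\<close>

lemma schwartz_space_chirp:
  assumes "f \<in> schwartz_space"
  shows "(\<lambda>x. chirp s x * f x) \<in> schwartz_space"
proof (rule schwartz_space_coinduct)
  let ?B = "(\<lambda>f x. chirp s x * f x) ` schwartz_space"
  show "(\<lambda>x. chirp s x * f x) \<in> ?B"
    using assms by blast
  have d: "chirp s differentiable (at x)" for x
    using has_derivative_chirp differentiable_def by blast
  fix g assume "g \<in> ?B"
  then obtain f where g: "g = (\<lambda>x. chirp s x * f x)" and f: "f \<in> schwartz_space"
    by blast
  show "rapidly_decreasing g"
    unfolding g by (rule rapidly_decreasing_scale[of f _ 1])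
      (use f schwartz_space_rapidly_decreasing in \<open>auto simp: norm_mult\<close>)
  show "g differentiable (at x)" for x
    unfolding g using d f schwartz_space_differentiable by auto
  show "partial_deriv j g \<in> ?B" for j
  proof
    show "partial_deriv j g =
        (\<lambda>x. chirp s x * (2 * \<i> * of_real (s $ j) * (of_real (x $ j) * f x) + partial_deriv j f x))"
      unfolding g using f
      by (subst partial_deriv_mult)
        (auto simp: d schwartz_space_differentiable partial_deriv_chirp algebra_simps)
    show "(\<lambda>x. 2 * \<i> * of_real (s $ j) * (of_real (x $ j) * f x) + partial_deriv j f x)
        \<in> schwartz_space"
      by (intro schwartz_space_add schwartz_space_scale schwartz_space_coord
          schwartz_space_partial_deriv f)
  qed
qed

section \<open>Integrable majorants on the plane\<close>

lemma integrable_lborel_even: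
  fixes f :: "real \<Rightarrow> real"
  assumes f[measurable]: "f \<in> borel_measurable borel" and even: "\<And>t. f (- t) = f t"
    and int: "integrable lborel (\<lambda>t. indicator {0..} t * f t)"
  shows "integrable lborel f"
proof -
  have "integrable lborel (\<lambda>t. indicator {0..} (0 + (-1) * t) * f (0 + (-1) * t))"
    by (rule lborel_integrable_real_affine[OF int]) simp
  then have "integrable lborel (\<lambda>t. \<bar>indicator {0..} t * f t\<bar> + \<bar>indicator {0..} (- t) * f t\<bar>)"
    using int by (simp add: even)
  then show ?thesis
    by (rule Bochner_Integration.integrable_bound) (auto simp: indicator_def)
qed

lemma Basis_real2: "(Basis :: (real^2) set) = {axis 1 1, axis 2 1}"
  by (auto simp: Basis_vec_def UNIV_2)

text \<open>The majorants for the singular integral are built from products of one integrable function in each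
  coordinate, which reduces their integrability to one-dimensional calculus.\<close>

lemma integrable_lborel_prod_real2:
  fixes f :: "real \<Rightarrow> real"
  assumes int: "integrable lborel f" and nn: "\<And>t. 0 \<le> f t"
  shows "integrable lborel (\<lambda>x::real^2. f (x $ 1) * f (x $ 2))"
proof -
  have [measurable]: "f \<in> borel_measurable borel"
    using borel_measurable_integrable[OF int] by simp
  have "(axis 1 1 :: real^2) \<noteq> axis 2 1"
    by (simp add: axis_eq_axis)
  then have "(\<integral>\<^sup>+x. ennreal (f (x $ 1) * f (x $ 2)) \<partial>(lborel :: (real^2) measure))
      = (\<integral>\<^sup>+x. (\<Prod>b\<in>Basis. ennreal (f (x \<bullet> b))) \<partial>(lborel :: (real^2) measure))"
    by (simp add: Basis_real2 inner_axis ennreal_mult nn)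
  also have "\<dots> = (\<Prod>b\<in>(Basis :: (real^2) set). \<integral>\<^sup>+t. ennreal (f t) \<partial>lborel)"
    by (intro nn_integral_lborel_prod) auto
  also have "\<dots> < \<infinity>"
    using int \<open>(axis 1 1 :: real^2) \<noteq> axis 2 1\<close>
    by (simp add: Basis_real2 integrable_iff_bounded nn ennreal_mult_less_top)
  finally show ?thesis
    by (simp add: integrable_iff_bounded nn)
qed

lemma integrable_Cauchy_density: "integrable lborel (\<lambda>t::real. inverse (1 + t\<^sup>2))"
proof (rule integrable_lborel_even)
  have "(\<integral>\<^sup>+t. ennreal (inverse (1 + t\<^sup>2)) * indicator {0..} t \<partial>lborel) = pi / 2 - arctan 0"
    by (rule nn_integral_FTC_atLeast) (auto intro: DERIV_arctan tendsto_arctan_at_top)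
  also have "(\<integral>\<^sup>+t. ennreal (inverse (1 + t\<^sup>2)) * indicator {0..} t \<partial>lborel)
      = (\<integral>\<^sup>+t. ennreal (norm (indicator {0..} t * inverse (1 + t\<^sup>2) :: real)) \<partial>lborel)"
    by (intro nn_integral_cong) (auto simp: indicator_def)
  finally show "integrable lborel (\<lambda>t::real. indicator {0..} t * inverse (1 + t\<^sup>2))"
    by (simp add: integrable_iff_bounded)
qed auto

definition weight :: "real^2 \<Rightarrow> real" where
  "weight x = inverse (1 + (x $ 1)\<^sup>2) * inverse (1 + (x $ 2)\<^sup>2)"

lemma weight_measurable [measurable]: "weight \<in> borel_measurable borel"
  unfolding weight_def by measurable

lemma integrable_weight: "integrable lborel weight"
  unfolding weight_def by (rule integrable_lborel_prod_real2[OF integrable_Cauchy_density]) simp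

lemma integrable_lebesgue_weight: "integrable lebesgue weight"
  using integrable_weight by (simp add: integrable_completion)

lemma weight_pos: "0 < weight x"
  by (simp add: weight_def add_pos_nonneg)

lemma weight_le_1: "weight x \<le> 1"
  unfolding weight_def by (intro mult_le_one) (auto simp: inverse_le_1_iff add_pos_nonneg)

lemma weight_uminus: "weight (- x) = weight x"
  by (simp add: weight_def)

text \<open>Translation costs only a constant factor depending on the shift, since
  \<open>1 + b\<^sup>2 \<le> 2 (1 + a\<^sup>2) (1 + (a - b)\<^sup>2)\<close> in each coordinate.\<close>

lemma weight_diff_le: "weight (x - z) \<le> 4 / weight x * weight z"
proof -
  have *: "inverse (1 + (a - b)\<^sup>2) \<le> 2 * (1 + a\<^sup>2) * inverse (1 + b\<^sup>2)" for a b :: real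
  proof -
    have "b\<^sup>2 \<le> 2 * a\<^sup>2 + 2 * (a - b)\<^sup>2"
      using zero_le_power2[of "2 * a - b"] by (simp add: power2_eq_square algebra_simps)
    then have "1 + b\<^sup>2 \<le> 2 + 2 * a\<^sup>2 + 2 * (a - b)\<^sup>2 + 2 * (a\<^sup>2 * (a - b)\<^sup>2)"
      using mult_nonneg_nonneg[OF zero_le_power2[of a] zero_le_power2[of "a - b"]] by linarith
    also have "\<dots> = 2 * (1 + a\<^sup>2) * (1 + (a - b)\<^sup>2)"
      by (simp add: distrib_left distrib_right)
    finally have "1 + b\<^sup>2 \<le> 2 * (1 + a\<^sup>2) * (1 + (a - b)\<^sup>2)" .
    then show ?thesis
      by (simp add: divide_simps add_pos_nonneg)
  qed
  have "weight (x - z) \<le> (2 * (1 + (x $ 1)\<^sup>2) * inverse (1 + (z $ 1)\<^sup>2)) *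
      (2 * (1 + (x $ 2)\<^sup>2) * inverse (1 + (z $ 2)\<^sup>2))"
    unfolding weight_def by (intro mult_mono) (use * in \<open>auto simp: vector_minus_component\<close>)
  also have "\<dots> = 4 / weight x * weight z"
    by (simp add: weight_def field_simps)
  finally show ?thesis .
qed

lemma rapidly_decreasing_le_weight:
  assumes "rapidly_decreasing f"
  obtains C where "C \<ge> 0" "\<And>x. norm (f x) \<le> C * weight x"
proof -
  have "\<exists>C. \<forall>x. \<bar>x $ 1\<bar> ^ m * \<bar>x $ 2\<bar> ^ n * norm (f x) \<le> C" for m n
    using assms by (simp add: rapidly_decreasing_iff)
  then obtain C where C: "\<And>m n x. \<bar>x $ 1\<bar> ^ m * \<bar>x $ 2\<bar> ^ n * norm (f x) \<le> C m n"
    by metis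
  let ?C = "C 0 0 + C 2 0 + C 0 2 + C 2 2"
  have *: "norm (f x) \<le> ?C * weight x" for x
  proof -
    have "(1 + (x $ 1)\<^sup>2) * (1 + (x $ 2)\<^sup>2) * norm (f x) \<le> ?C"
      using C[of x 0 0] C[of x 2 0] C[of x 0 2] C[of x 2 2] by (simp add: algebra_simps)
    moreover have "0 < (1 + (x $ 1)\<^sup>2) * (1 + (x $ 2)\<^sup>2)"
      by (simp add: add_pos_nonneg)
    ultimately show ?thesis
      by (simp add: weight_def field_simps)
  qed
  have "0 \<le> ?C * weight 0"
    by (rule order_trans[OF norm_ge_zero *])
  then have "0 \<le> ?C"
    using weight_pos[of 0] by (simp add: zero_le_mult_iff)
  then show ?thesis
    using * that by blast
qed

lemma schwartz_space_borel: "f \<in> schwartz_space \<Longrightarrow> f \<in> borel_measurable borel"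
  by (intro borel_measurable_continuous_onI differentiable_imp_continuous_on)
    (simp add: differentiable_on_def differentiable_at_withinI schwartz_space_differentiable)

lemma schwartz_space_lebesgue: "f \<in> schwartz_space \<Longrightarrow> f \<in> borel_measurable lebesgue"
  using measurable_completion[of f lborel borel] schwartz_space_borel[of f] by simp

text \<open>A substitute for the Hoelder inequality with a free parameter.  Where \<open>norm z \<le> \<epsilon>\<close> the first term
  suffices; elsewhere \<open>norm z = norm z powr (1 - p) * norm z powr p\<close>, where the first factor has a
  non-positive exponent and the weight is at most \<open>1\<close>.\<close>

lemma norm_mult_weight_le:
  fixes z :: complex
  assumes "0 < \<epsilon>" "1 \<le> p"
  shows "norm z * weight x \<le> \<epsilon> * weight x + \<epsilon> powr (1 - p) * norm z powr p"
proof (cases "norm z \<le> \<epsilon>")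
  case True
  then have "norm z * weight x \<le> \<epsilon> * weight x"
    using weight_pos[of x] by (intro mult_right_mono) auto
  then show ?thesis
    by (simp add: add_increasing2)
next
  case False
  then have z: "\<epsilon> < norm z" by simp
  have "norm z * weight x \<le> norm z * 1"
    by (intro mult_left_mono weight_le_1) auto
  also have "\<dots> = norm z powr (1 - p) * norm z powr p"
    using z assms by (simp flip: powr_add)
  also have "\<dots> \<le> \<epsilon> powr (1 - p) * norm z powr p"
    using z assms by (intro mult_right_mono powr_mono2') auto
  finally show ?thesis
    using weight_pos[of x] assms by (simp add: add_increasing)
qed

lemma
  assumes g: "g \<in> Lp_space p" and p: "1 \<le> p"
  shows integrable_Lp_mult_weight: "integrable lebesgue (\<lambda>x. norm (g x) * weight x)" (is ?A)
    and integral_Lp_mult_weight_le: "0 < \<epsilon> \<Longrightarrow> (LINT x|lebesgue. norm (g x) * weight x)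
      \<le> \<epsilon> * (LINT x|lebesgue. weight x) + \<epsilon> powr (1 - p) * (LINT x|lebesgue. norm (g x) powr p)"
proof -
  have [measurable]: "g \<in> borel_measurable lebesgue"
    and int: "integrable lebesgue (\<lambda>x. norm (g x) powr p)"
    using g by (auto simp: Lp_space_def)
  have [measurable]: "weight \<in> borel_measurable lebesgue"
    using integrable_lebesgue_weight by auto
  have int2: "integrable lebesgue (\<lambda>x. \<epsilon> * weight x + \<epsilon> powr (1 - p) * norm (g x) powr p)" for \<epsilon>
    using int integrable_lebesgue_weight by auto
  show A: ?A
    by (rule Bochner_Integration.integrable_bound[OF int2[of 1]])
      (use norm_mult_weight_le[OF zero_less_one p] weight_pos in \<open>auto simp: abs_mult less_imp_le intro!: AE_I2\<close>)
  assume \<epsilon>: "0 < \<epsilon>"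
  have "(LINT x|lebesgue. norm (g x) * weight x)
      \<le> (LINT x|lebesgue. \<epsilon> * weight x + \<epsilon> powr (1 - p) * norm (g x) powr p)"
    by (intro integral_mono A int2 norm_mult_weight_le \<epsilon> p)
  also have "\<dots> = \<epsilon> * (LINT x|lebesgue. weight x) + \<epsilon> powr (1 - p) * (LINT x|lebesgue. norm (g x) powr p)"
    using int integrable_lebesgue_weight by simp
  finally show "(LINT x|lebesgue. norm (g x) * weight x)
      \<le> \<epsilon> * (LINT x|lebesgue. weight x) + \<epsilon> powr (1 - p) * (LINT x|lebesgue. norm (g x) powr p)" .
qed

lemma schwartz_space_subset_Lp_space:
  assumes f: "f \<in> schwartz_space" and p: "1 \<le> p"
  shows "f \<in> Lp_space p"
proof -
  have [measurable]: "f \<in> borel_measurable lebesgue"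
    using f by (rule schwartz_space_lebesgue)
  obtain C where C: "C \<ge> 0" "\<And>x. norm (f x) \<le> C * weight x"
    using rapidly_decreasing_le_weight[OF schwartz_space_rapidly_decreasing[OF f]] by blast
  have "integrable lebesgue (\<lambda>x. norm (f x) powr p)"
  proof (rule Bochner_Integration.integrable_bound)
    show "integrable lebesgue (\<lambda>x. C powr p * weight x)"
      using integrable_lebesgue_weight by simp
    have "norm (f x) powr p \<le> C powr p * weight x" for x
    proof -
      have "norm (f x) powr p \<le> (C * weight x) powr p"
        using C p by (intro powr_mono2) auto
      also have "\<dots> = C powr p * weight x powr p"
        using C weight_pos[of x] by (simp add: powr_mult)
      also have "\<dots> \<le> C powr p * weight x powr 1"
        using p weight_pos[of x] weight_le_1[of x] by (intro mult_left_mono powr_mono') auto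
      finally show ?thesis using weight_pos[of x] by simp
    qed
    then show "AE x in lebesgue. norm (norm (f x) powr p) \<le> norm (C powr p * weight x)"
      using weight_pos by (auto simp: abs_mult less_imp_le)
  qed auto
  then show ?thesis
    by (simp add: Lp_space_def)
qed

text \<open>The inequality \<open>\<bar>z\<^sub>1\<bar> \<bar>z\<^sub>2\<bar> \<le> \<bar>z\<bar>\<^sup>2\<close> bounds the planar singularity \<open>1 / \<bar>z\<bar>\<close> by a product of
  one-dimensional singularities of order one half.\<close>

definition root_singularity :: "real \<Rightarrow> real" where
  "root_singularity t = indicator {-1..1} t * \<bar>t\<bar> powr (-1/2)"

lemma root_singularity_measurable [measurable]: "root_singularity \<in> borel_measurable borel"
  unfolding root_singularity_def by measurable

lemma integrable_root_singularity: "integrable lborel root_singularity"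
proof (rule integrable_lborel_even)
  have "(\<lambda>t::real. t powr (-1/2)) absolutely_integrable_on {0..1}"
    by (intro nonnegative_absolutely_integrable_1 integrable_on_powr_from_0) auto
  then have "integrable lebesgue (\<lambda>t::real. indicator {0..1} t * t powr (-1/2))"
    by (simp add: set_integrable_def)
  moreover have "(\<lambda>t::real. indicator {0..1} t * t powr (-1/2)) =
      (\<lambda>t. indicator {0..} t * root_singularity t)"
    by (auto simp: root_singularity_def indicator_def fun_eq_iff)
  ultimately show "integrable lborel (\<lambda>t. indicator {0..} t * root_singularity t)"
    by (simp add: integrable_completion)
qed (auto simp: root_singularity_def indicator_def)

lemma AE_coordinate_nonzero: "AE z in lborel. (z :: real^2) $ k \<noteq> 0"
proof -
  have "negligible {z :: real^2. z $ k = 0}"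
    by (rule negligible_standard_hyperplane_cart)
  then have "AE z in lebesgue. (z :: real^2) $ k \<noteq> 0"
    by (auto simp: negligible_iff_null_sets dest!: AE_not_in)
  then show ?thesis
    by (simp add: AE_completion_iff)
qed

lemma inverse_norm_le_root_singularity:
  fixes z :: "real^2"
  assumes "z $ 1 \<noteq> 0" "z $ 2 \<noteq> 0" "norm z \<le> 1"
  shows "inverse (norm z) \<le> root_singularity (z $ 1) * root_singularity (z $ 2)"
proof -
  have "\<bar>z $ 1\<bar> * \<bar>z $ 2\<bar> \<le> norm z * norm z"
    by (intro mult_mono component_le_norm_cart) auto
  then have le: "sqrt (\<bar>z $ 1\<bar> * \<bar>z $ 2\<bar>) \<le> norm z"
    by (intro real_le_lsqrt) (auto simp: power2_eq_square)
  have "\<bar>z $ 1\<bar> \<le> 1" "\<bar>z $ 2\<bar> \<le> 1"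
    using component_le_norm_cart[of z] assms(3) order_trans by blast+
  then have "root_singularity (z $ 1) * root_singularity (z $ 2) = (\<bar>z $ 1\<bar> * \<bar>z $ 2\<bar>) powr (-1/2)"
    by (simp add: root_singularity_def powr_mult abs_le_iff)
  also have "\<dots> = inverse (sqrt (\<bar>z $ 1\<bar> * \<bar>z $ 2\<bar>))"
    using powr_minus[of "\<bar>z $ 1\<bar> * \<bar>z $ 2\<bar>" "1/2"] by (simp add: powr_half_sqrt)
  finally show ?thesis
    using le assms by (simp add: le_imp_inverse_le)
qed

text \<open>Dominated convergence along a continuous parameter, by testing with sequences.\<close>

lemma integral_dominated_convergence_at:
  fixes s :: "'b::first_countable_topology \<Rightarrow> 'a \<Rightarrow> 'c::{banach, second_countable_topology}"
  assumes "f \<in> borel_measurable M" "\<And>t. t \<in> T \<Longrightarrow> s t \<in> borel_measurable M" "integrable M w"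
    and lim: "AE x in M. ((\<lambda>t. s t x) \<longlongrightarrow> f x) (at a within T)"
    and bound: "\<And>t. t \<in> T \<Longrightarrow> AE x in M. norm (s t x) \<le> w x"
  shows "((\<lambda>t. LINT x|M. s t x) \<longlongrightarrow> (LINT x|M. f x)) (at a within T)"
  unfolding tendsto_at_iff_sequentially comp_def
proof safe
  fix X :: "nat \<Rightarrow> 'b" assume X: "\<forall>i. X i \<in> T - {a}" "X \<longlonglongrightarrow> a"
  show "(\<lambda>n. LINT x|M. s (X n) x) \<longlonglongrightarrow> (LINT x|M. f x)"
  proof (rule integral_dominated_convergence[where w = w])
    show "AE x in M. (\<lambda>n. s (X n) x) \<longlonglongrightarrow> f x"
      using lim by eventually_elim (use X in \<open>auto simp: tendsto_at_iff_sequentially comp_def\<close>)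
  qed (use assms X in auto)
qed

section \<open>Lebesgue spaces and super-Gaussians\<close>

lemma norm_add_powr_le:
  fixes a b :: "'a::real_normed_vector"
  assumes "0 \<le> p"
  shows "norm (a + b) powr p \<le> 2 powr p * (norm a powr p + norm b powr p)"
proof -
  have "norm (a + b) powr p \<le> (2 * max (norm a) (norm b)) powr p"
    using assms norm_triangle_ineq[of a b] by (intro powr_mono2) auto
  also have "\<dots> = 2 powr p * max (norm a) (norm b) powr p"
    by (simp add: powr_mult)
  also have "\<dots> \<le> 2 powr p * (norm a powr p + norm b powr p)"
    by (intro mult_left_mono) (auto simp: max_def)
  finally show ?thesis .
qed

lemma Lp_space_add:
  assumes "0 \<le> p" "f \<in> Lp_space p" "g \<in> Lp_space p"
  shows "(\<lambda>x. f x + g x) \<in> Lp_space p"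
proof -
  have [measurable]: "f \<in> borel_measurable lebesgue" "g \<in> borel_measurable lebesgue"
    using assms by (auto simp: Lp_space_def)
  have "integrable lebesgue (\<lambda>x. norm (f x + g x) powr p)"
    by (rule Bochner_Integration.integrable_bound
        [where f = "\<lambda>x. 2 powr p * (norm (f x) powr p + norm (g x) powr p)"])
      (use assms norm_add_powr_le[of p] in \<open>auto simp: Lp_space_def abs_mult\<close>)
  then show ?thesis
    by (simp add: Lp_space_def)
qed

lemma Lp_space_mult_bounded:
  assumes g: "g \<in> Lp_space p" and [measurable]: "f \<in> borel_measurable lebesgue"
    and p: "0 \<le> p" and bd: "\<And>x. norm (f x) \<le> K * norm (g x)"
  shows "f \<in> Lp_space p"
proof -
  have le: "norm (f x) powr p \<le> \<bar>K\<bar> powr p * norm (g x) powr p" for x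
  proof -
    have "norm (f x) \<le> \<bar>K\<bar> * norm (g x)"
      using bd[of x] by (meson abs_ge_self mult_right_mono norm_ge_zero order_trans)
    then have "norm (f x) powr p \<le> (\<bar>K\<bar> * norm (g x)) powr p"
      using p by (intro powr_mono2) auto
    then show ?thesis by (simp add: powr_mult)
  qed
  have "integrable lebesgue (\<lambda>x. norm (f x) powr p)"
    by (rule Bochner_Integration.integrable_bound
        [OF integrable_mult_right[of "\<bar>K\<bar> powr p" lebesgue "\<lambda>x. norm (g x) powr p"]])
      (use g le in \<open>auto simp: Lp_space_def abs_mult\<close>)
  then show ?thesis
    by (simp add: Lp_space_def)
qed

lemma Lp_space_scale:
  assumes "0 \<le> p" "f \<in> Lp_space p"
  shows "(\<lambda>x. c * f x) \<in> Lp_space p"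
proof (rule Lp_space_mult_bounded)
  show "(\<lambda>x. c * f x) \<in> borel_measurable lebesgue"
    using assms by (auto simp: Lp_space_def)
qed (use assms in \<open>auto simp: norm_mult\<close>)

lemma Lp_space_diff:
  assumes "0 \<le> p" "f \<in> Lp_space p" "g \<in> Lp_space p"
  shows "(\<lambda>x. f x - g x) \<in> Lp_space p"
  using Lp_space_add[OF assms(1,2) Lp_space_scale[OF assms(1,3), of "-1"]] by simp

lemma Lp_dominated_convergence:
  assumes F: "\<And>n. F n \<in> Lp_space p" and p: "0 < p"
    and h: "integrable lebesgue (\<lambda>x. h x powr p)" and [measurable]: "f \<in> borel_measurable lebesgue"
    and le: "\<And>n x. norm (F n x) \<le> h x"
    and lim: "AE x in lebesgue. (\<lambda>n. F n x) \<longlonglongrightarrow> f x"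
  shows "f \<in> Lp_space p" "(\<lambda>n. LINT x|lebesgue. norm (F n x - f x) powr p) \<longlonglongrightarrow> 0"
proof -
  have [measurable]: "F n \<in> borel_measurable lebesgue" for n
    using F by (simp add: Lp_space_def)
  have h0: "0 \<le> h x" for x
    using le[of undefined x] norm_ge_zero order_trans by blast
  have le': "AE x in lebesgue. norm (f x) \<le> h x"
    using lim
  proof eventually_elim
    case (elim x)
    then show ?case
      using le by (intro tendsto_upperbound[OF tendsto_norm[OF elim]]) auto
  qed
  have "integrable lebesgue (\<lambda>x. norm (f x) powr p)"
    by (rule Bochner_Integration.integrable_bound[OF h])
      (use le' p in \<open>auto elim!: eventually_mono intro!: powr_mono2\<close>)
  then show "f \<in> Lp_space p"
    by (simp add: Lp_space_def)
  have "(\<lambda>n. LINT x|lebesgue. norm (F n x - f x) powr p) \<longlonglongrightarrow> (LINT x|(lebesgue :: (real^2) measure). 0)"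
  proof (rule integral_dominated_convergence[where w = "\<lambda>x. 2 powr p * (2 * h x powr p)"])
    show "AE x in lebesgue. (\<lambda>n. norm (F n x - f x) powr p) \<longlonglongrightarrow> 0"
      using lim
    proof eventually_elim
      case (elim x)
      then have "(\<lambda>n. norm (F n x - f x)) \<longlonglongrightarrow> 0"
        by (simp add: LIM_zero tendsto_norm_zero)
      then show ?case
        using p by (intro tendsto_zero_powrI[of _ _ "\<lambda>_. p" p]) auto
    qed
    show "AE x in lebesgue. norm (norm (F n x - f x) powr p) \<le> 2 powr p * (2 * h x powr p)" for n
      using le'
    proof eventually_elim
      case (elim x)
      have "norm (F n x - f x) powr p \<le> 2 powr p * (norm (F n x) powr p + norm (f x) powr p)"
        using p norm_add_powr_le[of p "F n x" "- f x"] by simp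
      also have "\<dots> \<le> 2 powr p * (h x powr p + h x powr p)"
        using elim le p h0 by (intro mult_left_mono add_mono powr_mono2) auto
      finally show ?case by simp
    qed
  qed (use h in auto)
  then show "(\<lambda>n. LINT x|lebesgue. norm (F n x - f x) powr p) \<longlonglongrightarrow> 0"
    by simp
qed

text \<open>As \<open>i\<close> grows, these functions approach the indicator of \<open>{-1<..<1}\<close>.  Their derivatives are
  polynomials times the function itself, so products of them over the coordinates are Schwartz
  functions that approximate box indicators.  The exponent is at least
  \<open>2\<close>, so that every member decays at infinity.\<close>

definition super_gaussian :: "nat \<Rightarrow> real \<Rightarrow> real" where
  "super_gaussian i u = exp (- (u ^ (2 * Suc i)))"

lemma super_gaussian_le_exp: "super_gaussian i u \<le> exp (1 - \<bar>u\<bar>)"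
proof -
  have "\<bar>u\<bar> - 1 \<le> u ^ (2 * Suc i)"
  proof (cases "\<bar>u\<bar> \<le> 1")
    case True
    then have "\<bar>u\<bar> - 1 \<le> 0" by simp
    also have "0 \<le> u ^ (2 * Suc i)" by (rule zero_le_even_power) simp
    finally show ?thesis .
  next
    case False
    then have "\<bar>u\<bar> ^ 1 \<le> \<bar>u\<bar> ^ (2 * Suc i)"
      by (intro power_increasing) simp_all
    also have "\<dots> = u ^ (2 * Suc i)"
      by (simp only: power_mult power2_abs)
    finally show ?thesis by simp
  qed
  then show ?thesis
    by (simp add: super_gaussian_def)
qed

text \<open>The first member of the family dominates all others up to a constant, so it can serve as the
  majorant for the limit \<open>i \<longlonglongrightarrow> \<infinity>\<close>.\<close>

lemma super_gaussian_le: "super_gaussian i u \<le> exp 1 * super_gaussian 0 u"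
proof -
  have "u\<^sup>2 - 1 \<le> (u\<^sup>2) ^ Suc i"
  proof (cases "u\<^sup>2 \<le> 1")
    case True
    then have "u\<^sup>2 - 1 \<le> 0" by simp
    also have "0 \<le> (u\<^sup>2) ^ Suc i" by simp
    finally show ?thesis .
  next
    case False
    then have "(u\<^sup>2) ^ 1 \<le> (u\<^sup>2) ^ Suc i"
      by (intro power_increasing) auto
    then show ?thesis by simp
  qed
  then show ?thesis
    by (simp add: super_gaussian_def power_mult power2_eq_square flip: exp_add)
qed

lemma super_gaussian_tendsto:
  assumes "\<bar>u\<bar> \<noteq> 1"
  shows "(\<lambda>i. super_gaussian i u) \<longlonglongrightarrow> indicator {-1<..<1} u"
proof (cases "\<bar>u\<bar> < 1")
  case True
  then have "u\<^sup>2 < 1" by (simp add: abs_square_less_1)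
  then have "(\<lambda>i. (u\<^sup>2) ^ Suc i) \<longlonglongrightarrow> 0"
    by (intro LIMSEQ_Suc LIMSEQ_power_zero) auto
  then have "(\<lambda>i. exp (- ((u\<^sup>2) ^ Suc i))) \<longlonglongrightarrow> exp (- 0)"
    by (intro tendsto_intros)
  then show ?thesis
    using True by (simp only: super_gaussian_def power_mult) (simp add: indicator_def abs_less_iff)
next
  case False
  then have "1 < u\<^sup>2"
    using assms abs_square_le_1[of u] by (simp add: not_le[symmetric])
  then have "filterlim (\<lambda>i. norm ((u\<^sup>2) ^ Suc i)) at_top sequentially"
    by (intro filterlim_compose[OF filterlim_at_infinity_imp_norm_at_top
          [OF filterlim_realpow_sequentially_gt1] filterlim_Suc]) auto
  then have "filterlim (\<lambda>i. (u\<^sup>2) ^ Suc i) at_top sequentially"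
    by simp
  then have "(\<lambda>i. exp (- ((u\<^sup>2) ^ Suc i))) \<longlonglongrightarrow> 0"
    by (intro filterlim_compose[OF exp_at_bot] filterlim_compose[OF filterlim_uminus_at_bot_at_top])
  then show ?thesis
    using False by (simp only: super_gaussian_def power_mult) (auto simp: indicator_def abs_less_iff)
qed

lemma power_mult_super_gaussian_bounded:
  assumes r: "0 < r"
  shows "\<exists>C. \<forall>t. \<bar>t\<bar> ^ m * super_gaussian i (r * (t - c)) \<le> C"
proof (intro exI allI)
  fix t
  let ?u = "r * (t - c)" and ?K = "\<bar>c\<bar> + 1 / r"
  have "\<bar>t\<bar> \<le> \<bar>c\<bar> + \<bar>t - c\<bar>" by simp
  also have "\<dots> = \<bar>c\<bar> + 1 / r * \<bar>?u\<bar>"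
    using r by (simp add: abs_mult)
  also have "\<dots> \<le> ?K * (1 + \<bar>?u\<bar>)"
    using r mult_nonneg_nonneg[of "\<bar>c\<bar>" "\<bar>?u\<bar>"] by (simp only: distrib_left distrib_right) simp
  finally have "\<bar>t\<bar> ^ m \<le> (?K * (1 + \<bar>?u\<bar>)) ^ m"
    by (intro power_mono) auto
  also have "\<dots> = ?K ^ m * (1 + \<bar>?u\<bar>) ^ m"
    by (rule power_mult_distrib)
  also have "\<dots> \<le> ?K ^ m * ((1 + real m) ^ m * exp (1 + \<bar>?u\<bar>))"
  proof (intro mult_left_mono)
    show "(1 + \<bar>?u\<bar>) ^ m \<le> (1 + real m) ^ m * exp (1 + \<bar>?u\<bar>)"
    proof (cases "m = 0")
      case False
      \<comment> \<open>This brings in the form \<open>(1 + y / m) ^ m \<le> exp y\<close> of the exponential bound.\<close>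
      have "1 + \<bar>?u\<bar> \<le> (1 + real m) * (1 + (1 + \<bar>?u\<bar>) / real m)"
        using False by (simp add: field_simps)
      then have "(1 + \<bar>?u\<bar>) ^ m \<le> ((1 + real m) * (1 + (1 + \<bar>?u\<bar>) / real m)) ^ m"
        by (intro power_mono) auto
      also have "\<dots> = (1 + real m) ^ m * (1 + (1 + \<bar>?u\<bar>) / real m) ^ m"
        by (rule power_mult_distrib)
      also have "\<dots> \<le> (1 + real m) ^ m * exp (1 + \<bar>?u\<bar>)"
        using False by (intro mult_left_mono exp_ge_one_plus_x_over_n_power_n) auto
      finally show ?thesis .
    qed simp
  qed (use r in auto)
  finally have "\<bar>t\<bar> ^ m * super_gaussian i ?u
      \<le> ?K ^ m * ((1 + real m) ^ m * exp (1 + \<bar>?u\<bar>)) * exp (1 - \<bar>?u\<bar>)"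
    using r by (intro mult_mono super_gaussian_le_exp) (auto simp: super_gaussian_def)
  also have "\<dots> = ?K ^ m * (1 + real m) ^ m * (exp (1 + \<bar>?u\<bar>) * exp (1 - \<bar>?u\<bar>))"
    by (simp only: mult.assoc)
  also have "exp (1 + \<bar>?u\<bar>) * exp (1 - \<bar>?u\<bar>) = exp 2"
    by (simp flip: exp_add)
  finally show "\<bar>t\<bar> ^ m * super_gaussian i ?u \<le> ?K ^ m * (1 + real m) ^ m * exp 2" .
qed

text \<open>The vector \<open>c\<close> is the centre and \<open>r\<close> holds the inverse half-widths of the approximated box.\<close>

definition plane_super_gaussian :: "nat \<Rightarrow> real^2 \<Rightarrow> real^2 \<Rightarrow> real^2 \<Rightarrow> complex" where
  "plane_super_gaussian i c r x = of_real (super_gaussian i (r $ 1 * (x $ 1 - c $ 1)) *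
     super_gaussian i (r $ 2 * (x $ 2 - c $ 2)))"

lemma has_derivative_plane_super_gaussian:
  "(plane_super_gaussian i c r has_derivative
     (\<lambda>h. - (\<Sum>k\<in>UNIV. of_nat (2 * Suc i) * (of_real (r $ k) * of_real (h $ k)) *
         (of_real (r $ k) * (of_real (x $ k) - of_real (c $ k))) ^ Suc (2 * i)) *
        plane_super_gaussian i c r x)) (at x)"
proof -
  have eq: "plane_super_gaussian i c r = (\<lambda>x. exp (- (
      (of_real (r $ 1) * (of_real (x $ 1) - of_real (c $ 1))) ^ Suc (Suc (2 * i)) +
      (of_real (r $ 2) * (of_real (x $ 2) - of_real (c $ 2))) ^ Suc (Suc (2 * i)))))"
    by (rule ext) (simp only: plane_super_gaussian_def super_gaussian_def exp_of_real[symmetric]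
        exp_add[symmetric] of_real_add of_real_minus of_real_power of_real_mult of_real_diff
        minus_add_distrib mult_Suc_right add_2_eq_Suc)
  have "((\<lambda>x::real^2. of_real (r $ k) * (of_real (x $ k) - of_real (c $ k))) has_derivative
      (\<lambda>h. of_real (r $ k) * complex_of_real (h $ k))) (at x)" for k
    using has_derivative_mult_right[OF has_derivative_diff[OF has_derivative_coord has_derivative_const]]
    by simp
  from has_derivative_power[OF this, where n = "Suc (Suc (2 * i))"]
  have "((\<lambda>x::real^2. (of_real (r $ k) * (of_real (x $ k) - of_real (c $ k))) ^ Suc (Suc (2 * i)))
      has_derivative (\<lambda>h. of_nat (2 * Suc i) * (of_real (r $ k) * complex_of_real (h $ k)) *
        (of_real (r $ k) * (of_real (x $ k) - of_real (c $ k))) ^ Suc (2 * i))) (at x)" for k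
    by (simp only: diff_Suc_1 mult_Suc_right add_2_eq_Suc)
  from has_derivative_minus[OF has_derivative_add[OF this[of 1] this[of 2]]]
  have "((\<lambda>x::real^2. - ((of_real (r $ 1) * (of_real (x $ 1) - of_real (c $ 1))) ^ Suc (Suc (2 * i)) +
      (of_real (r $ 2) * (of_real (x $ 2) - of_real (c $ 2))) ^ Suc (Suc (2 * i))))
      has_derivative (\<lambda>h. - (\<Sum>k\<in>UNIV. of_nat (2 * Suc i) * (of_real (r $ k) * complex_of_real (h $ k)) *
        (of_real (r $ k) * (of_real (x $ k) - of_real (c $ k))) ^ Suc (2 * i)))) (at x)"
    by (simp only: sum_2)
  from has_derivative_compose[OF this DERIV_exp[unfolded has_field_derivative_def]] show ?thesis
    unfolding eq by (subst mult.commute)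
qed

lemma coord_span_affine_power:
  "f \<in> coord_span B \<Longrightarrow> (\<lambda>x. (r * (of_real (x $ j) - c)) ^ n * f x) \<in> coord_span B"
proof (induction n)
  case (Suc n)
  let ?f = "\<lambda>x. (r * (of_real (x $ j) - c)) ^ n * f x"
  have "(\<lambda>x. r * (of_real (x $ j) * ?f x + (- c) * ?f x)) \<in> coord_span B"
    by (intro coord_span.scale coord_span.add coord_span.coord Suc)
  moreover have "(\<lambda>x. r * (of_real (x $ j) * ?f x + (- c) * ?f x)) =
      (\<lambda>x. (r * (of_real (x $ j) - c)) ^ Suc n * f x)"
    by (rule ext) (simp add: algebra_simps)
  ultimately show ?case by simp
qed simp

text \<open>Each partial derivative is a power of an affine coordinate function times the function itself,
  hence lies in the span of this single function.\<close>

lemma schwartz_space_plane_super_gaussian: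
  assumes r: "0 < r $ 1" "0 < r $ 2"
  shows "plane_super_gaussian i c r \<in> schwartz_space"
proof -
  let ?G = "plane_super_gaussian i c r"
  have "rapidly_decreasing ?G"
    unfolding rapidly_decreasing_iff
  proof (intro allI)
    fix m n
    obtain C where C: "\<And>t. \<bar>t\<bar> ^ m * super_gaussian i (r $ 1 * (t - c $ 1)) \<le> C"
      using power_mult_super_gaussian_bounded[OF r(1)] by blast
    obtain D where D: "\<And>t. \<bar>t\<bar> ^ n * super_gaussian i (r $ 2 * (t - c $ 2)) \<le> D"
      using power_mult_super_gaussian_bounded[OF r(2)] by blast
    have nn: "0 \<le> super_gaussian i u" for u by (simp add: super_gaussian_def)
    have "0 \<le> C" by (rule order_trans[OF _ C[of 0]]) (simp add: nn)
    have "\<bar>x $ 1\<bar> ^ m * \<bar>x $ 2\<bar> ^ n * norm (?G x) \<le> C * D" for x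
    proof -
      have "\<bar>x $ 1\<bar> ^ m * \<bar>x $ 2\<bar> ^ n * norm (?G x) =
          (\<bar>x $ 1\<bar> ^ m * super_gaussian i (r $ 1 * (x $ 1 - c $ 1))) *
          (\<bar>x $ 2\<bar> ^ n * super_gaussian i (r $ 2 * (x $ 2 - c $ 2)))"
        using nn by (simp add: plane_super_gaussian_def norm_mult)
      also have "\<dots> \<le> C * D"
        using C D \<open>0 \<le> C\<close> nn by (intro mult_mono) auto
      finally show ?thesis .
    qed
    then show "\<exists>C. \<forall>x. \<bar>x $ 1\<bar> ^ m * \<bar>x $ 2\<bar> ^ n * norm (?G x) \<le> C"
      by blast
  qed
  moreover have "?G differentiable (at x)" for x
    using has_derivative_plane_super_gaussian differentiable_def by blast
  moreover have "partial_deriv j ?G \<in> coord_span {?G}" for j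
  proof -
    have "(\<Sum>k\<in>UNIV. of_nat (2 * Suc i) * (of_real (r $ k) * complex_of_real (axis j 1 $ k)) *
         (of_real (r $ k) * (of_real (x $ k) - of_real (c $ k))) ^ Suc (2 * i)) =
        of_nat (2 * Suc i) * of_real (r $ j) *
         (of_real (r $ j) * (of_real (x $ j) - of_real (c $ j))) ^ Suc (2 * i)" for x
      using exhaust_2[of j] by (elim disjE) (simp_all add: axis_def sum_2 del: power_Suc)
    then have "partial_deriv j ?G = (\<lambda>x. (- of_nat (2 * Suc i) * of_real (r $ j)) *
        ((of_real (r $ j) * (of_real (x $ j) - of_real (c $ j))) ^ Suc (2 * i) * ?G x))"
      by (intro ext) (simp only: partial_deriv_eqI[OF has_derivative_plane_super_gaussian]
          mult_minus_left mult.assoc)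
    then show ?thesis
      by (simp only:) (intro coord_span.scale coord_span_affine_power coord_span.base singletonI)
  qed
  ultimately have "coord_span {?G} \<subseteq> schwartz_space"
    by (intro coord_span_subset_schwartz_space) auto
  then show ?thesis
    using coord_span.base[of ?G "{?G}"] by blast
qed

section \<open>Density of the Schwartz space\<close>

lemma super_gaussian_nonneg: "0 \<le> super_gaussian i u"
  by (simp add: super_gaussian_def)

lemma super_gaussian_le_1: "super_gaussian i u \<le> 1"
  unfolding super_gaussian_def exp_le_one_iff neg_le_0_iff_le by (rule zero_le_even_power) simp

lemma norm_plane_super_gaussian_le:
  "norm (plane_super_gaussian i c r x) \<le> exp 2 * norm (plane_super_gaussian 0 c r x)"
proof -
  have "super_gaussian i u * super_gaussian i v
      \<le> (exp 1 * super_gaussian 0 u) * (exp 1 * super_gaussian 0 v)" for u v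
    by (intro mult_mono super_gaussian_le) (auto simp: super_gaussian_nonneg)
  also have "(exp 1 * super_gaussian 0 u) * (exp 1 * super_gaussian 0 v) =
      exp 2 * (super_gaussian 0 u * super_gaussian 0 v)" for u v
    by (simp add: mult_exp_exp)
  finally show ?thesis
    unfolding plane_super_gaussian_def norm_of_real
    by (simp only: abs_of_nonneg[OF mult_nonneg_nonneg[OF super_gaussian_nonneg super_gaussian_nonneg]])
qed

lemma AE_notin_box_frontier: "AE x in lebesgue. x \<notin> cbox a b - box a (b :: real^2)"
  using negligible_frontier_interval[of a b] unfolding negligible_iff_null_sets by (rule AE_not_in)

lemma plane_super_gaussian_tendsto:
  fixes a b :: "real^2"
  assumes ab: "\<And>k. a $ k < b $ k" and x: "x \<notin> cbox a b - box a b"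
  shows "(\<lambda>i. plane_super_gaussian i (\<chi> k. (a $ k + b $ k) / 2) (\<chi> k. 2 / (b $ k - a $ k)) x)
    \<longlonglongrightarrow> indicator (box a b) x"
proof -
  define u where "u = (\<lambda>k. 2 / (b $ k - a $ k) * (x $ k - (a $ k + b $ k) / 2))"
  have u: "\<bar>u k\<bar> < 1 \<longleftrightarrow> a $ k < x $ k \<and> x $ k < b $ k"
    "\<bar>u k\<bar> \<le> 1 \<longleftrightarrow> a $ k \<le> x $ k \<and> x $ k \<le> b $ k" for k
    using ab[of k] unfolding u_def by (auto simp: abs_less_iff abs_le_iff field_simps)
  have lim: "(\<lambda>i. super_gaussian i (u 1) * super_gaussian i (u 2)) \<longlonglongrightarrow> indicator (box a b) x"
  proof (cases "x \<in> box a b")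
    case True
    then have lt: "\<bar>u k\<bar> < 1" for k
      unfolding u by (simp add: mem_box_cart)
    then have "indicator {-1<..<1} (u k) = (1 :: real)" for k
      by (simp add: indicator_def abs_less_iff minus_less_iff)
    moreover have "(\<lambda>i. super_gaussian i (u 1) * super_gaussian i (u 2)) \<longlonglongrightarrow>
        indicator {-1<..<1} (u 1) * indicator {-1<..<1} (u 2)"
      by (intro tendsto_mult super_gaussian_tendsto) (use lt[of 1] lt[of 2] in linarith)+
    ultimately show ?thesis
      using True by simp
  next
    case False
    then have "x \<notin> cbox a b" using x by blast
    then obtain k where k: "\<not> \<bar>u k\<bar> \<le> 1"
      unfolding u by (auto simp: mem_box_cart)
    have "(\<lambda>i. super_gaussian i (u k)) \<longlonglongrightarrow> indicator {-1<..<1} (u k)"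
      by (rule super_gaussian_tendsto) (use k in auto)
    moreover have "indicator {-1<..<1} (u k) = (0 :: real)"
      using k by (auto simp: indicator_def)
    ultimately have lim0: "(\<lambda>i. super_gaussian i (u k)) \<longlonglongrightarrow> 0" by simp
    note bd = super_gaussian_nonneg super_gaussian_le_1
    have "(\<lambda>i. super_gaussian i (u 1) * super_gaussian i (u 2)) \<longlonglongrightarrow> 0"
    proof (rule tendsto_sandwich[OF _ _ tendsto_const lim0])
      show "\<forall>\<^sub>F i in sequentially. super_gaussian i (u 1) * super_gaussian i (u 2) \<le> super_gaussian i (u k)"
        using exhaust_2[of k] bd by (auto intro!: always_eventually mult_left_le mult_left_le_one_le)
    qed (simp add: bd)
    then show ?thesis
      using False by simp
  qed
  have "(\<lambda>i. complex_of_real (super_gaussian i (u 1) * super_gaussian i (u 2)))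
      \<longlonglongrightarrow> of_real (indicator (box a b) x)"
    by (rule tendsto_of_real[OF lim])
  moreover have "complex_of_real (indicator (box a b) x) = indicator (box a b) x"
    by (cases "x \<in> box a b") auto
  ultimately show ?thesis
    by (simp add: plane_super_gaussian_def u_def)
qed

text \<open>Density of the Schwartz space, as an induction rule: a property of Schwartz functions that is
  stable under linear combinations and limits in norm holds on the whole space.  Super-Gaussians
  converge to indicators of boxes, Dynkin's lemma reaches the indicators of all bounded Borel sets,
  a change on null sets those of bounded Lebesgue sets, and every member of the space is a dominated
  limit of truncated simple functions.\<close>

lemma Lp_space_schwartz_induct [consumes 2, case_names schwartz add scale limit]:
  assumes f: "f \<in> Lp_space p" and p: "1 \<le> p"
    and schwartz: "\<And>\<phi>. \<phi> \<in> schwartz_space \<Longrightarrow> P \<phi>"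
    and add: "\<And>f g. f \<in> Lp_space p \<Longrightarrow> g \<in> Lp_space p \<Longrightarrow> P f \<Longrightarrow> P g \<Longrightarrow> P (\<lambda>x. f x + g x)"
    and scale: "\<And>c f. f \<in> Lp_space p \<Longrightarrow> P f \<Longrightarrow> P (\<lambda>x. c * f x)"
    and limit: "\<And>F f. (\<And>n. F n \<in> Lp_space p) \<Longrightarrow> (\<And>n. P (F n)) \<Longrightarrow> f \<in> Lp_space p \<Longrightarrow>
      (\<lambda>n. LINT x|lebesgue. norm (F n x - f x) powr p) \<longlonglongrightarrow> 0 \<Longrightarrow> P f"
  shows "P f"
proof -
  define Q where "Q f \<longleftrightarrow> f \<in> Lp_space p \<and> P f" for f
  have p0: "0 < p" "0 \<le> p" using p by auto
  have Q_schwartz: "Q \<phi>" if "\<phi> \<in> schwartz_space" for \<phi>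
    using that p schwartz schwartz_space_subset_Lp_space by (auto simp: Q_def)
  have Q_add: "Q (\<lambda>x. f x + g x)" if "Q f" "Q g" for f g
    using that add Lp_space_add p0 by (auto simp: Q_def)
  have Q_scale: "Q (\<lambda>x. c * f x)" if "Q f" for f c
    using that scale Lp_space_scale p0 by (auto simp: Q_def)
  have Q_lim: "Q f" if "\<And>n. Q (F n)" "integrable lebesgue (\<lambda>x. h x powr p)" "f \<in> borel_measurable lebesgue"
    "\<And>n x. norm (F n x) \<le> h x" "AE x in lebesgue. (\<lambda>n. F n x) \<longlonglongrightarrow> f x" for F f h
    using Lp_dominated_convergence[of F p h f] that limit[of F f] p0 by (auto simp: Q_def)
  have Q_AE: "Q f" if "Q g" "AE x in lebesgue. g x = f x" "f \<in> borel_measurable lebesgue" for f g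
  proof (rule Q_lim)
    show "Q ((\<lambda>_::nat. g) n)" for n using that by simp
    show "integrable lebesgue (\<lambda>x. norm (g x) powr p)"
      using that(1) by (simp add: Q_def Lp_space_def)
    show "AE x in lebesgue. (\<lambda>_::nat. g x) \<longlonglongrightarrow> f x"
      using that(2) by eventually_elim simp
  qed (use that in auto)
  have Q_0: "Q (\<lambda>x. 0)"
    using Q_scale[OF Q_schwartz[OF schwartz_space_plane_super_gaussian[of "\<chi> k. 1"]], of 0] by simp
  have Q_box: "Q (indicator (box a b))" for a b :: "real^2"
  proof (cases "\<forall>k. a $ k < b $ k")
    case True
    let ?G = "\<lambda>i. plane_super_gaussian i (\<chi> k. (a $ k + b $ k) / 2) (\<chi> k. 2 / (b $ k - a $ k))"
    have G: "?G i \<in> schwartz_space" for i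
      by (rule schwartz_space_plane_super_gaussian) (use True in auto)
    show ?thesis
    proof (rule Q_lim)
      show "Q (?G i)" for i
        using G by (rule Q_schwartz)
      show "AE x in lebesgue. (\<lambda>i. ?G i x) \<longlonglongrightarrow> indicator (box a b) x"
        using AE_notin_box_frontier[of a b]
        by eventually_elim (use True in \<open>auto intro!: plane_super_gaussian_tendsto\<close>)
      have "(\<lambda>x. exp 2 * ?G 0 x) \<in> Lp_space p"
        by (intro Lp_space_scale schwartz_space_subset_Lp_space G p p0)
      then show "integrable lebesgue (\<lambda>x. (exp 2 * norm (?G 0 x)) powr p)"
        by (simp add: Lp_space_def norm_mult norm_exp)
      show "norm (?G i x) \<le> exp 2 * norm (?G 0 x)" for i x
        by (rule norm_plane_super_gaussian_le)
      show "indicator (box a b) \<in> borel_measurable lebesgue"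
        by (intro borel_measurable_indicator) simp
    qed
  next
    case False
    then obtain k where "b $ k \<le> a $ k"
      by (auto simp: not_less)
    then have "x \<notin> box a b" for x
      by (auto simp: mem_box_cart intro!: exI[of _ k])
    then have "box a b = {}"
      by blast
    then have "indicator (box a b) = (\<lambda>_. 0 :: complex)"
      by (simp add: fun_eq_iff)
    then show ?thesis using Q_0 by simp
  qed
  define B :: "nat \<Rightarrow> (real^2) set" where "B N = box (\<chi> k. - real N) (\<chi> k. real N)" for N
  have B_lebesgue [measurable]: "B N \<in> sets lebesgue" for N
    by (simp add: B_def)
  have B_int: "integrable lebesgue (\<lambda>x. indicator (B N) x powr p)" for N
  proof -
    have "(\<lambda>x. norm (indicator (B N) x :: complex) powr p) = (\<lambda>x. indicator (B N) x powr p)"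
      by (auto simp: indicator_def fun_eq_iff)
    then show ?thesis
      using Q_box[of "\<chi> k. - real N" "\<chi> k. real N"] by (simp add: Q_def Lp_space_def B_def)
  qed
  \<comment> \<open>Intersecting with a fixed bounded box keeps complements in the space.\<close>
  have Q_borel: "Q (indicator (A \<inter> B N))" if "A \<in> sets borel" for A N
  proof -
    have "Int_stable (range (\<lambda>(a, b). box a b :: (real^2) set))"
      by (auto simp: Int_stable_def box_Int_box)
    moreover have "range (\<lambda>(a, b). box a b :: (real^2) set) \<subseteq> Pow UNIV"
      by simp
    moreover have "A \<in> sigma_sets UNIV (range (\<lambda>(a, b). box a b))"
      using that by (simp add: borel_eq_box)
    ultimately show ?thesis
    proof (induction rule: sigma_sets_induct_disjoint)
      case (basic A)
      then show ?case
        by (auto simp: B_def box_Int_box intro: Q_box)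
    next
      case empty
      then show ?case using Q_0 by simp
    next
      case (compl A)
      have "Q (\<lambda>x. indicator (B N) x + (- 1) * indicator (A \<inter> B N) x)"
        by (intro Q_add Q_scale compl.IH) (simp add: B_def Q_box)
      moreover have "(\<lambda>x. indicator (B N) x + (- 1) * indicator (A \<inter> B N) x :: complex)
          = indicator ((UNIV - A) \<inter> B N)"
        by (auto simp: indicator_def fun_eq_iff)
      ultimately show ?case by simp
    next
      case (union F)
      have F: "F i \<in> sets borel" for i
        using union.hyps by (auto simp: borel_eq_box)
      have Q_union: "Q (indicator ((\<Union>i<n. F i) \<inter> B N))" for n
      proof (induction n)
        case (Suc n)
        have "Q (\<lambda>x. indicator ((\<Union>i<n. F i) \<inter> B N) x + indicator (F n \<inter> B N) x)"
          by (intro Q_add Suc union.IH)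
        moreover have "F n \<inter> F i = {}" if "i < n" for i
          using disjoint_family_onD[OF union.hyps(1), of n i] that by simp
        then have "F n \<inter> (\<Union>i<n. F i) = {}"
          by blast
        then have "(\<lambda>x. indicator ((\<Union>i<n. F i) \<inter> B N) x + indicator (F n \<inter> B N) x :: complex)
            = indicator ((\<Union>i<Suc n. F i) \<inter> B N)"
          by (auto simp: indicator_def fun_eq_iff lessThan_Suc)
        ultimately show ?case by simp
      qed (simp add: Q_0)
      show ?case
      proof (rule Q_lim[OF Q_union B_int])
        have "(\<lambda>n. indicator ((\<Union>i<n. F i) \<inter> B N) x) \<longlonglongrightarrow> (indicator ((\<Union>i. F i) \<inter> B N) x :: complex)" for x
          using LIMSEQ_indicator_UN[of "\<lambda>i. F i \<inter> B N" x] by (simp only: UN_extend_simps)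
        then show "AE x in lebesgue. (\<lambda>n. indicator ((\<Union>i<n. F i) \<inter> B N) x)
            \<longlonglongrightarrow> (indicator ((\<Union>i. F i) \<inter> B N) x :: complex)"
          by simp
        have "(\<Union>i. F i) \<in> sets lebesgue"
          using F by (intro sets.countable_UN') auto
        then show "indicator ((\<Union>i. F i) \<inter> B N) \<in> borel_measurable lebesgue"
          by simp
      qed (auto simp: indicator_def)
    qed
  qed
  have Q_lebesgue: "Q (indicator (A \<inter> B N))" if A: "A \<in> sets lebesgue" for A N
  proof -
    obtain S N1 N' where S: "A = S \<union> N1" "N1 \<subseteq> N'" "N' \<in> null_sets lborel" "S \<in> sets lborel"
      using sets_completionE[OF A] .
    show ?thesis
    proof (rule Q_AE[OF Q_borel])
      show "S \<in> sets borel" using S by simp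
      have "AE x in lborel. x \<notin> N'"
        using S(3) by (rule AE_not_in)
      then have "AE x in lebesgue. x \<notin> N'"
        by (rule AE_completion)
      then show "AE x in lebesgue. indicator (S \<inter> B N) x = (indicator (A \<inter> B N) x :: complex)"
        by eventually_elim (use S in \<open>auto simp: indicator_def\<close>)
      show "indicator (A \<inter> B N) \<in> borel_measurable lebesgue"
        using A by simp
    qed
  qed
  have f_meas [measurable]: "f \<in> borel_measurable lebesgue"
    using f by (simp add: Lp_space_def)
  obtain F where F: "\<And>i. simple_function lebesgue (F i)" "\<And>x. (\<lambda>i. F i x) \<longlonglongrightarrow> f x"
    "\<And>i x. dist (F i x) 0 \<le> 2 * dist (f x) 0"
    using borel_measurable_implies_sequence_metric[OF f_meas, of 0] by auto
  \<comment> \<open>Truncation to \<open>B i\<close> makes the level sets bounded.\<close>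
  have Q_simple: "Q (\<lambda>x. F i x * indicator (B i) x)" for i
  proof -
    have fin: "finite (range (F i))"
      using simple_functionD(1)[OF F(1)] by simp
    have "Q (\<lambda>x. \<Sum>v\<in>V. v * indicator (F i -` {v} \<inter> B i) x)" if "finite V" for V
      using that
    proof induction
      case (insert v V)
      have "F i -` {v} \<in> sets lebesgue"
        using simple_functionD(2)[OF F(1), of i "{v}"] by simp
      then have "Q (\<lambda>x. v * indicator (F i -` {v} \<inter> B i) x + (\<Sum>v\<in>V. v * indicator (F i -` {v} \<inter> B i) x))"
        by (intro Q_add Q_scale Q_lebesgue insert.IH)
      then show ?case
        using insert.hyps by (simp only: sum.insert not_False_eq_True)
    qed (simp add: Q_0)
    from this[OF fin] have "Q (\<lambda>x. \<Sum>v\<in>range (F i). v * indicator (F i -` {v} \<inter> B i) x)" .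
    moreover have "(\<Sum>v\<in>range (F i). v * indicator (F i -` {v} \<inter> B i) x) = F i x * indicator (B i) x" for x
    proof -
      have "(\<Sum>v\<in>range (F i). v * indicator (F i -` {v} \<inter> B i) x) =
          (\<Sum>v\<in>range (F i). if v = F i x then v * indicator (B i) x else 0)"
        by (intro sum.cong) (auto simp: indicator_def)
      then show ?thesis
        using fin by simp
    qed
    ultimately show ?thesis by simp
  qed
  have "Q f"
  proof (rule Q_lim[OF Q_simple])
    have "(\<lambda>x. 2 * f x) \<in> Lp_space p"
      by (intro Lp_space_scale f p0)
    then show "integrable lebesgue (\<lambda>x. (2 * norm (f x)) powr p)"
      by (simp add: Lp_space_def norm_mult)
    show "norm (F i x * indicator (B i) x) \<le> 2 * norm (f x)" for i x
      using F(3)[of i x] by (auto simp: indicator_def)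
    have "(\<lambda>i. F i x * indicator (B i) x) \<longlonglongrightarrow> f x" for x
    proof (rule Lim_transform_eventually[OF F(2)])
      obtain N where N: "norm x < real N"
        using reals_Archimedean2 by blast
      have "x \<in> B i" if "i \<ge> N" for i
      proof -
        have "\<bar>x $ k\<bar> < real i" for k
          using component_le_norm_cart[of x k] N that by linarith
        then show ?thesis by (auto simp: B_def mem_box_cart abs_less_iff) (metis minus_less_iff)
      qed
      then show "\<forall>\<^sub>F i in sequentially. F i x = F i x * indicator (B i) x"
        by (auto simp: eventually_sequentially intro!: exI[of _ N])
    qed
    then show "AE x in lebesgue. (\<lambda>i. F i x * indicator (B i) x) \<longlonglongrightarrow> f x"
      by simp
  qed fact
  then show ?thesis by (simp add: Q_def)
qed

section \<open>Convergence of the extended operators\<close>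

lemma integral_norm_add_powr_le:
  assumes "0 \<le> p" "f \<in> Lp_space p" "g \<in> Lp_space p"
  shows "(LINT x|lebesgue. norm (f x + g x) powr p)
    \<le> 2 powr p * ((LINT x|lebesgue. norm (f x) powr p) + (LINT x|lebesgue. norm (g x) powr p))"
proof -
  have int: "integrable lebesgue (\<lambda>x. norm (f x) powr p)" "integrable lebesgue (\<lambda>x. norm (g x) powr p)"
    using assms by (auto simp: Lp_space_def)
  have "(LINT x|lebesgue. norm (f x + g x) powr p)
      \<le> (LINT x|lebesgue. 2 powr p * (norm (f x) powr p + norm (g x) powr p))"
  proof (intro integral_mono norm_add_powr_le assms(1))
    show "integrable lebesgue (\<lambda>x. norm (f x + g x) powr p)"
      using Lp_space_add[OF assms] by (simp add: Lp_space_def)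
    show "integrable lebesgue (\<lambda>x. 2 powr p * (norm (f x) powr p + norm (g x) powr p))"
      using int by simp
  qed
  also have "\<dots> = 2 powr p * ((LINT x|lebesgue. norm (f x) powr p) + (LINT x|lebesgue. norm (g x) powr p))"
    using int by simp
  finally show ?thesis .
qed

lemma
  assumes "is_bounded_Lp_extension p T T'"
  shows is_bounded_Lp_extension_in_Lp: "f \<in> Lp_space p \<Longrightarrow> T' f \<in> Lp_space p"
    and is_bounded_Lp_extension_add: "f \<in> Lp_space p \<Longrightarrow> g \<in> Lp_space p \<Longrightarrow>
      AE x in lebesgue. T' (\<lambda>y. f y + g y) x = T' f x + T' g x"
    and is_bounded_Lp_extension_scale: "f \<in> Lp_space p \<Longrightarrow> AE x in lebesgue. T' (\<lambda>y. c * f y) x = c * T' f x"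
    and is_bounded_Lp_extension_schwartz: "\<phi> \<in> schwartz_space \<Longrightarrow> AE x in lebesgue. T' \<phi> x = T \<phi> x"
  using assms by (simp_all add: is_bounded_Lp_extension_def)

lemma is_bounded_Lp_extension_powr:
  assumes ext: "is_bounded_Lp_extension p T T'" and p: "0 < p"
  obtains K where "0 \<le> K" "\<And>f. f \<in> Lp_space p \<Longrightarrow>
    (LINT x|lebesgue. norm (T' f x) powr p) \<le> K * (LINT x|lebesgue. norm (f x) powr p)"
proof -
  obtain C where C: "\<And>f. f \<in> Lp_space p \<Longrightarrow> Lp_norm p (T' f) \<le> C * Lp_norm p f"
    using ext unfolding is_bounded_Lp_extension_def by blast
  have "(LINT x|lebesgue. norm (T' f x) powr p) \<le> \<bar>C\<bar> powr p * (LINT x|lebesgue. norm (f x) powr p)"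
    if "f \<in> Lp_space p" for f
  proof -
    have powr: "Lp_norm p g powr p = (LINT x|lebesgue. norm (g x) powr p)" for g
      using p by (simp add: Lp_norm_def powr_powr)
    have nn: "0 \<le> Lp_norm p g" for g by (simp add: Lp_norm_def)
    have "Lp_norm p (T' f) \<le> \<bar>C\<bar> * Lp_norm p f"
      using C[OF that] nn[of f] by (meson abs_ge_self mult_right_mono order_trans)
    then have "Lp_norm p (T' f) powr p \<le> (\<bar>C\<bar> * Lp_norm p f) powr p"
      using p nn by (intro powr_mono2) auto
    then show ?thesis
      by (simp add: powr_mult nn powr)
  qed
  then show ?thesis
    using that[of "\<bar>C\<bar> powr p"] by simp
qed

text \<open>If \<open>f\<close> is a limit of functions \<open>F n\<close> on which the two extensions agree, then
  \<open>T1 f - T2 f = T1 (f - F n) - T2 (f - F n)\<close> almost everywhere, and the right-hand side is small in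
  norm by boundedness.\<close>

lemma is_bounded_Lp_extension_unique:
  assumes p: "1 \<le> p" and ext1: "is_bounded_Lp_extension p T T1" and ext2: "is_bounded_Lp_extension p T T2"
    and f: "f \<in> Lp_space p"
  shows "AE x in lebesgue. T1 f x = T2 f x"
  using f p
proof (induction rule: Lp_space_schwartz_induct)
  case (schwartz \<phi>)
  show ?case
    using is_bounded_Lp_extension_schwartz[OF ext1 schwartz] is_bounded_Lp_extension_schwartz[OF ext2 schwartz]
    by eventually_elim simp
next
  case (add f g)
  show ?case
    using is_bounded_Lp_extension_add[OF ext1 add(1,2)] is_bounded_Lp_extension_add[OF ext2 add(1,2)] add(3,4)
    by eventually_elim simp
next
  case (scale c f)
  show ?case
    using is_bounded_Lp_extension_scale[OF ext1 scale(1), where c = c]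
      is_bounded_Lp_extension_scale[OF ext2 scale(1), where c = c] scale(2)
    by eventually_elim simp
next
  case (limit F f)
  have p0: "0 < p" "0 \<le> p" using p by auto
  obtain K1 where K1: "0 \<le> K1" "\<And>f. f \<in> Lp_space p \<Longrightarrow>
    (LINT x|lebesgue. norm (T1 f x) powr p) \<le> K1 * (LINT x|lebesgue. norm (f x) powr p)"
    using is_bounded_Lp_extension_powr[OF ext1 p0(1)] by blast
  obtain K2 where K2: "0 \<le> K2" "\<And>f. f \<in> Lp_space p \<Longrightarrow>
    (LINT x|lebesgue. norm (T2 f x) powr p) \<le> K2 * (LINT x|lebesgue. norm (f x) powr p)"
    using is_bounded_Lp_extension_powr[OF ext2 p0(1)] by blast
  note T_Lp = is_bounded_Lp_extension_in_Lp[OF ext1] is_bounded_Lp_extension_in_Lp[OF ext2]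
  let ?D = "\<lambda>x. T1 f x - T2 f x"
  have D: "?D \<in> Lp_space p"
    by (intro Lp_space_diff p0 T_Lp limit)
  then have [measurable]: "?D \<in> borel_measurable lebesgue"
    by (simp add: Lp_space_def)
  let ?e = "\<lambda>n. LINT x|lebesgue. norm (F n x - f x) powr p"
  have bound: "(LINT x|lebesgue. norm (?D x) powr p) \<le> 2 powr p * (K1 * ?e n + K2 * ?e n)" for n
  proof -
    let ?g = "\<lambda>x. f x - F n x"
    have g: "?g \<in> Lp_space p"
      by (intro Lp_space_diff p0 limit)
    have Fn: "F n \<in> Lp_space p" "AE x in lebesgue. T1 (F n) x = T2 (F n) x"
      by (rule limit)+
    have "AE x in lebesgue. ?D x = T1 ?g x + (-1) * T2 ?g x"
      using is_bounded_Lp_extension_add[OF ext1 Fn(1) g]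
        is_bounded_Lp_extension_add[OF ext2 Fn(1) g] Fn(2)
      by eventually_elim simp
    then have "(LINT x|lebesgue. norm (?D x) powr p) = (LINT x|lebesgue. norm (T1 ?g x + (-1) * T2 ?g x) powr p)"
    proof (intro integral_cong_AE)
      assume "AE x in lebesgue. ?D x = T1 ?g x + (-1) * T2 ?g x"
      then show "AE x in lebesgue. norm (?D x) powr p = norm (T1 ?g x + (-1) * T2 ?g x) powr p"
        by eventually_elim simp
      have "T1 ?g \<in> borel_measurable lebesgue" "T2 ?g \<in> borel_measurable lebesgue"
        using T_Lp[OF g] by (auto simp: Lp_space_def)
      then show "(\<lambda>x. norm (T1 ?g x + (-1) * T2 ?g x) powr p) \<in> borel_measurable lebesgue"
        by measurable
    qed measurable
    also have "\<dots> \<le> 2 powr p * ((LINT x|lebesgue. norm (T1 ?g x) powr p) +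
        (LINT x|lebesgue. norm ((-1) * T2 ?g x) powr p))"
      by (intro integral_norm_add_powr_le Lp_space_scale T_Lp g p0)
    also have "\<dots> \<le> 2 powr p * (K1 * (LINT x|lebesgue. norm (?g x) powr p) + K2 * (LINT x|lebesgue. norm (?g x) powr p))"
      using K1(2)[OF g] K2(2)[OF g] by (intro mult_left_mono add_mono) auto
    finally show ?thesis
      by (simp only: norm_minus_commute)
  qed
  have "(\<lambda>n. 2 powr p * (K1 * ?e n + K2 * ?e n)) \<longlonglongrightarrow> 2 powr p * (K1 * 0 + K2 * 0)"
    by (intro tendsto_intros limit)
  then have "(LINT x|lebesgue. norm (?D x) powr p) \<le> 2 powr p * (K1 * 0 + K2 * 0)"
    by (rule LIMSEQ_le_const) (use bound in blast)
  then have "(LINT x|lebesgue. norm (?D x) powr p) \<le> 0"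
    by simp
  then have "(LINT x|lebesgue. norm (?D x) powr p) = 0"
    by (intro antisym integral_nonneg_AE) auto
  then have "AE x in lebesgue. norm (?D x) powr p = 0"
    using D by (subst (asm) integral_nonneg_eq_0_iff_AE) (auto simp: Lp_space_def)
  then show ?case
    by eventually_elim simp
qed

lemma chirp_measurable_lebesgue [measurable]: "chirp s \<in> borel_measurable lebesgue"
proof -
  have "continuous_on UNIV (chirp s)"
    unfolding chirp_def by (intro continuous_intros)
  then have "chirp s \<in> borel_measurable borel"
    by (rule borel_measurable_continuous_onI)
  then have "chirp s \<in> lborel \<rightarrow>\<^sub>M borel"
    by (simp only: measurable_lborel2)
  then show ?thesis
    by (rule measurable_completion)
qed

lemma Lp_space_chirp:
  assumes "0 \<le> p" "f \<in> Lp_space p"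
  shows "(\<lambda>x. chirp s x * f x) \<in> Lp_space p"
proof (rule Lp_space_mult_bounded[OF assms(2) _ assms(1)])
  have [measurable]: "f \<in> borel_measurable lebesgue"
    using assms by (simp add: Lp_space_def)
  show "(\<lambda>x. chirp s x * f x) \<in> borel_measurable lebesgue"
    by measurable
  show "norm (chirp s x * f x) \<le> 1 * norm (f x)" for x
    by (simp add: norm_mult)
qed

lemma Lp_space_chirp_minus_1:
  assumes "0 \<le> p" "f \<in> Lp_space p"
  shows "(\<lambda>x. (chirp s x - 1) * f x) \<in> Lp_space p"
  using Lp_space_diff[OF assms(1) Lp_space_chirp[OF assms] assms(2)] by (simp add: left_diff_distrib)

text \<open>Conjugation by chirps transports bounded extensions, because a chirp has modulus one and preserves
  the Schwartz space.\<close>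

lemma is_bounded_Lp_extension_chirp:
  assumes p: "0 \<le> p" and ext: "is_bounded_Lp_extension p T T'"
    and S: "\<And>\<phi> x. \<phi> \<in> schwartz_space \<Longrightarrow> S \<phi> x = chirp u x * T (\<lambda>y. chirp v y * \<phi> y) x"
  shows "is_bounded_Lp_extension p S (\<lambda>f x. chirp u x * T' (\<lambda>y. chirp v y * f y) x)"
  unfolding is_bounded_Lp_extension_def
proof (intro conjI ballI allI)
  fix f g and c :: complex assume f: "f \<in> Lp_space p" 
  let ?f = "\<lambda>y. chirp v y * f y" and ?g = "\<lambda>y. chirp v y * g y"
  have f': "?f \<in> Lp_space p" by (intro Lp_space_chirp p f)
  then have "T' ?f \<in> Lp_space p"
    by (rule is_bounded_Lp_extension_in_Lp[OF ext])
  then show "(\<lambda>x. chirp u x * T' (\<lambda>y. chirp v y * f y) x) \<in> Lp_space p"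
    by (rule Lp_space_chirp[OF p])
  have "AE x in lebesgue. T' (\<lambda>y. c * ?f y) x = c * T' ?f x"
    by (rule is_bounded_Lp_extension_scale[OF ext f'])
  then show "AE x in lebesgue. chirp u x * T' (\<lambda>y. chirp v y * (c * f y)) x =
      c * (chirp u x * T' (\<lambda>y. chirp v y * f y) x)"
    by eventually_elim (simp add: mult.left_commute)
  assume g: "g \<in> Lp_space p"
  have g': "?g \<in> Lp_space p" by (intro Lp_space_chirp p g)
  have "AE x in lebesgue. T' (\<lambda>y. ?f y + ?g y) x = T' ?f x + T' ?g x"
    by (rule is_bounded_Lp_extension_add[OF ext f' g'])
  then show "AE x in lebesgue. chirp u x * T' (\<lambda>y. chirp v y * (f y + g y)) x =
      chirp u x * T' (\<lambda>y. chirp v y * f y) x + chirp u x * T' (\<lambda>y. chirp v y * g y) x"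
    by eventually_elim (simp add: distrib_left)
next
  have norm_eq: "Lp_norm p (\<lambda>x. chirp s x * h x) = Lp_norm p h" for s h
    by (simp add: Lp_norm_def norm_mult)
  obtain C where C: "\<And>f. f \<in> Lp_space p \<Longrightarrow> Lp_norm p (T' f) \<le> C * Lp_norm p f"
    using ext unfolding is_bounded_Lp_extension_def by blast
  have "Lp_norm p (\<lambda>x. chirp u x * T' (\<lambda>y. chirp v y * f y) x) \<le> C * Lp_norm p f"
    if "f \<in> Lp_space p" for f
    using C[OF Lp_space_chirp[OF p that, of v]] by (simp add: norm_eq)
  then show "\<exists>C. \<forall>f\<in>Lp_space p.
      Lp_norm p (\<lambda>x. chirp u x * T' (\<lambda>y. chirp v y * f y) x) \<le> C * Lp_norm p f"
    by blast
next
  fix \<phi> :: "real^2 \<Rightarrow> complex" assume \<phi>: "\<phi> \<in> schwartz_space"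
  then have "(\<lambda>y. chirp v y * \<phi> y) \<in> schwartz_space"
    by (rule schwartz_space_chirp)
  then have "AE x in lebesgue. T' (\<lambda>y. chirp v y * \<phi> y) x = T (\<lambda>y. chirp v y * \<phi> y) x"
    by (rule is_bounded_Lp_extension_schwartz[OF ext])
  then show "AE x in lebesgue. chirp u x * T' (\<lambda>y. chirp v y * \<phi> y) x = S \<phi> x"
    by eventually_elim (simp add: S[OF \<phi>])
qed

definition input_chirp :: "(2 \<Rightarrow> real^2^2) \<Rightarrow> real^2" where
  "input_chirp A = (\<chi> k. A k $ 1 $ 1 / (2 * A k $ 1 $ 2))"

definition output_chirp :: "(2 \<Rightarrow> real^2^2) \<Rightarrow> real^2" where
  "output_chirp A = (\<chi> k. A k $ 2 $ 2 / (2 * A k $ 1 $ 2))"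

lemma lc_riesz_eq_chirp_riesz:
  "lc_riesz A l f x = chirp (- output_chirp A) x * riesz l (\<lambda>y. chirp (input_chirp A) y * f y) x"
  by (simp add: lc_riesz_def riesz_def chirp_def input_chirp_def output_chirp_def sum_negf mult_ac)

lemma riesz_eq_chirp_lc_riesz:
  "riesz l f x = chirp (output_chirp A) x * lc_riesz A l (\<lambda>y. chirp (- input_chirp A) y * f y) x"
  by (simp add: lc_riesz_eq_chirp_riesz flip: mult.assoc)

text \<open>The conjugation can be inverted by the opposite chirps.\<close>

lemma ex_bounded_Lp_extension_lc_riesz_iff:
  assumes "0 \<le> p"
  shows "(\<exists>T'. is_bounded_Lp_extension p (lc_riesz A l) T') \<longleftrightarrow> (\<exists>T'. is_bounded_Lp_extension p (riesz l) T')"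
proof
  assume "\<exists>T'. is_bounded_Lp_extension p (lc_riesz A l) T'"
  then obtain T' where "is_bounded_Lp_extension p (lc_riesz A l) T'" ..
  from is_bounded_Lp_extension_chirp[OF assms this riesz_eq_chirp_lc_riesz]
  show "\<exists>T'. is_bounded_Lp_extension p (riesz l) T'" by blast
next
  assume "\<exists>T'. is_bounded_Lp_extension p (riesz l) T'"
  then obtain T' where "is_bounded_Lp_extension p (riesz l) T'" ..
  from is_bounded_Lp_extension_chirp[OF assms this lc_riesz_eq_chirp_riesz]
  show "\<exists>T'. is_bounded_Lp_extension p (lc_riesz A l) T'" by blast
qed

lemma is_bounded_Lp_extension_Lp_extension:
  assumes "is_bounded_Lp_extension p T T'"
  shows "is_bounded_Lp_extension p T (Lp_extension p T)"
  using assms someI[of "is_bounded_Lp_extension p T"] unfolding Lp_extension_def by auto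

lemma Lp_extension_in_Lp_space:
  assumes "0 < p" "f \<in> Lp_space p"
  shows "Lp_extension p T f \<in> Lp_space p"
proof (cases "\<exists>T'. is_bounded_Lp_extension p T T'")
  case True
  then have "is_bounded_Lp_extension p T (Lp_extension p T)"
    using is_bounded_Lp_extension_Lp_extension by blast
  then show ?thesis
    using assms is_bounded_Lp_extension_in_Lp by blast
next
  case False
  then show ?thesis
    using assms by (simp add: Lp_extension_def Lp_space_def)
qed

lemma tendsto_chirp: "((\<lambda>s. chirp s x) \<longlongrightarrow> 1) (at 0 within S)"
proof -
  have "((\<lambda>s. exp (\<i> * of_real (\<Sum>k\<in>UNIV. s $ k * (x $ k)\<^sup>2))) \<longlongrightarrow>
      exp (\<i> * of_real (\<Sum>k\<in>UNIV. (0 :: real^2) $ k * (x $ k)\<^sup>2))) (at 0 within S)"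
    by (intro tendsto_intros)
  then show ?thesis by (simp add: chirp_def)
qed

text \<open>Dominated convergence, as the integrand is at most \<open>(2 \<bar>f x\<bar>) powr p\<close>.\<close>

lemma Lp_chirp_minus_1_isCont:
  assumes p: "0 < p" and f: "f \<in> Lp_space p"
  shows "isCont (\<lambda>s. LINT x|lebesgue. norm ((chirp s x - 1) * f x) powr p) 0"
proof -
  have [measurable]: "f \<in> borel_measurable lebesgue"
    using f by (simp add: Lp_space_def)
  have "((\<lambda>s. LINT x|lebesgue. norm ((chirp s x - 1) * f x) powr p) \<longlongrightarrow>
      (LINT x|(lebesgue :: (real^2) measure). 0)) (at 0)"
  proof (rule integral_dominated_convergence_at[where w = "\<lambda>x. 2 powr p * norm (f x) powr p"])
    show "integrable lebesgue (\<lambda>x. 2 powr p * norm (f x) powr p)"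
      using f by (simp add: Lp_space_def)
    show "AE x in lebesgue. ((\<lambda>s. norm ((chirp s x - 1) * f x) powr p) \<longlongrightarrow> 0) (at 0)"
    proof (rule AE_I2)
      fix x
      have "((\<lambda>s. norm ((chirp s x - 1) * f x)) \<longlongrightarrow> norm ((1 - 1) * f x)) (at 0)"
        by (intro tendsto_intros tendsto_chirp)
      then show "((\<lambda>s. norm ((chirp s x - 1) * f x) powr p) \<longlongrightarrow> 0) (at 0)"
        using p by (intro tendsto_zero_powrI[of _ _ "\<lambda>_. p" p]) auto
    qed
    show "AE x in lebesgue. norm (norm ((chirp s x - 1) * f x) powr p) \<le> 2 powr p * norm (f x) powr p" for s
    proof (rule AE_I2)
      fix x
      have "norm (chirp s x - 1) \<le> 2"
        using norm_triangle_ineq4[of "chirp s x" 1] by simp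
      then have "norm ((chirp s x - 1) * f x) powr p \<le> (2 * norm (f x)) powr p"
        using p by (intro powr_mono2) (auto simp: norm_mult mult_right_mono)
      then show "norm (norm ((chirp s x - 1) * f x) powr p) \<le> 2 powr p * norm (f x) powr p"
        by (simp add: powr_mult)
    qed
  qed measurable
  then show ?thesis
    by (simp add: isCont_def)
qed

lemma tendsto_sharp_filter_0:
  assumes "\<And>\<delta> A. A \<in> sharp_nbhd \<delta> \<Longrightarrow> \<bar>f A\<bar> < \<delta>"
  shows "(f \<longlongrightarrow> (0::real)) sharp_filter"
  unfolding tendsto_iff eventually_sharp_filter using assms by (auto intro!: exI)

text \<open>The sign of \<open>b\<close> is not determined in the limit.  Its square is, since the determinant condition
  expresses it through the sharpness and the diagonal entries; so the square of the quotient is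
  shown to vanish.\<close>

lemma tendsto_over_b_sharp_filter:
  assumes "(f \<longlongrightarrow> (0::real)) sharp_filter"
  shows "((\<lambda>A. f A / (2 * A k $ 1 $ 2)) \<longlongrightarrow> 0) sharp_filter"
proof -
  have lims: "((\<lambda>A. sharpness (A k) + 1) \<longlongrightarrow> 0) sharp_filter"
    "((\<lambda>A. A k $ 1 $ 1) \<longlongrightarrow> 0) sharp_filter" "((\<lambda>A. A k $ 2 $ 2) \<longlongrightarrow> 0) sharp_filter"
    by (auto intro!: tendsto_sharp_filter_0 simp: sharp_nbhd_def)
  have lim: "((\<lambda>A. (f A)\<^sup>2 / (4 * (((sharpness (A k) + 1) - 1) * (A k $ 1 $ 1 * A k $ 2 $ 2 - 1)))) \<longlongrightarrow>
      0\<^sup>2 / (4 * ((0 - 1) * (0 * 0 - 1)))) sharp_filter"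
    by (intro tendsto_intros lims assms) simp
  have ev: "\<forall>\<^sub>F A in sharp_filter.
      (f A)\<^sup>2 / (4 * (((sharpness (A k) + 1) - 1) * (A k $ 1 $ 1 * A k $ 2 $ 2 - 1))) = (f A / (2 * A k $ 1 $ 2))\<^sup>2"
    unfolding eventually_sharp_filter
  proof (intro exI[of _ 1] conjI ballI)
    fix A assume "A \<in> sharp_nbhd 1"
    then have "det (A k) = 1" "A k $ 1 $ 2 \<noteq> 0" "A k $ 2 $ 1 \<noteq> 0"
      by (auto simp: sharp_nbhd_def admissible_def)
    then have "sharpness (A k) * (A k $ 1 $ 1 * A k $ 2 $ 2 - 1) = (A k $ 1 $ 2)\<^sup>2"
      by (simp add: sharpness_def det_2 field_simps power2_eq_square)
    then show "(f A)\<^sup>2 / (4 * (((sharpness (A k) + 1) - 1) * (A k $ 1 $ 1 * A k $ 2 $ 2 - 1))) = (f A / (2 * A k $ 1 $ 2))\<^sup>2"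
      by (simp add: power_divide power_mult_distrib)
  qed simp
  have "((\<lambda>A. (f A / (2 * A k $ 1 $ 2))\<^sup>2) \<longlongrightarrow> 0) sharp_filter"
    using Lim_transform_eventually[OF lim ev] by simp
  then have "((\<lambda>A. sqrt ((f A / (2 * A k $ 1 $ 2))\<^sup>2)) \<longlongrightarrow> sqrt 0) sharp_filter"
    by (rule tendsto_real_sqrt)
  then show ?thesis
    unfolding real_sqrt_abs real_sqrt_zero by (rule tendsto_rabs_zero_cancel)
qed

lemma
  shows tendsto_input_chirp: "(input_chirp \<longlongrightarrow> 0) sharp_filter"
    and tendsto_output_chirp: "((\<lambda>A. - output_chirp A) \<longlongrightarrow> 0) sharp_filter"
proof -
  have lims: "((\<lambda>A. A k $ 1 $ 1) \<longlongrightarrow> 0) sharp_filter" "((\<lambda>A. - (A k $ 2 $ 2)) \<longlongrightarrow> 0) sharp_filter" for k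
    by (auto intro!: tendsto_sharp_filter_0 simp: sharp_nbhd_def)
  show "(input_chirp \<longlongrightarrow> 0) sharp_filter"
    by (rule vec_tendstoI) (use tendsto_over_b_sharp_filter[OF lims(1)] in \<open>simp add: input_chirp_def\<close>)
  show "((\<lambda>A. - output_chirp A) \<longlongrightarrow> 0) sharp_filter"
    by (rule vec_tendstoI) (use tendsto_over_b_sharp_filter[OF lims(2)] in \<open>simp add: output_chirp_def\<close>)
qed

text \<open>With \<open>T\<close> the extended Riesz transform, \<open>u\<close> the input chirp and \<open>v\<close> the output chirp, the difference
  is \<open>v T ((u - 1) f) + (v - 1) T f\<close>.\<close>

lemma Lp_extension_lc_riesz_tendsto_powr:
  assumes p: "1 \<le> p" and f: "f \<in> Lp_space p"
  shows "((\<lambda>A. LINT x|lebesgue. norm (Lp_extension p (lc_riesz A l) f x - Lp_extension p (riesz l) f x) powr p)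
    \<longlongrightarrow> 0) sharp_filter"
proof (cases "\<exists>T'. is_bounded_Lp_extension p (riesz l) T'")
  case False
  then have "\<not> (\<exists>T'. is_bounded_Lp_extension p (lc_riesz A l) T')" for A
    using ex_bounded_Lp_extension_lc_riesz_iff[of p A l] p by simp
  with False show ?thesis
    by (simp add: Lp_extension_def)
next
  case True
  have p0: "0 < p" "0 \<le> p" using p by auto
  let ?T = "Lp_extension p (riesz l)" and ?S = "\<lambda>A. Lp_extension p (lc_riesz A l)"
  have T: "is_bounded_Lp_extension p (riesz l) ?T"
    using True is_bounded_Lp_extension_Lp_extension by blast
  have S: "is_bounded_Lp_extension p (lc_riesz A l) (?S A)" for A
    using True ex_bounded_Lp_extension_lc_riesz_iff[of p A l] p0
      is_bounded_Lp_extension_Lp_extension by blast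
  have Tf: "?T g \<in> Lp_space p" if "g \<in> Lp_space p" for g
    by (rule Lp_extension_in_Lp_space[OF p0(1) that])
  obtain K where K: "0 \<le> K" "\<And>f. f \<in> Lp_space p \<Longrightarrow>
    (LINT x|lebesgue. norm (?T f x) powr p) \<le> K * (LINT x|lebesgue. norm (f x) powr p)"
    using is_bounded_Lp_extension_powr[OF T p0(1)] by blast
  let ?I = "\<lambda>g s. LINT x|lebesgue. norm ((chirp s x - 1) * g x) powr p"
  have bound: "(LINT x|lebesgue. norm (?S A f x - ?T f x) powr p)
      \<le> 2 powr p * (K * ?I f (input_chirp A) + ?I (?T f) (- output_chirp A))" for A
  proof -
    let ?a = "input_chirp A" and ?d = "- output_chirp A"
    let ?h = "\<lambda>x. (chirp ?a x - 1) * f x"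
    have h: "?h \<in> Lp_space p"
      by (rule Lp_space_chirp_minus_1[OF p0(2) f])
    have "AE x in lebesgue. ?S A f x = chirp ?d x * ?T (\<lambda>y. chirp ?a y * f y) x"
      by (rule is_bounded_Lp_extension_unique[OF p S
            is_bounded_Lp_extension_chirp[OF p0(2) T lc_riesz_eq_chirp_riesz] f])
    moreover have "AE x in lebesgue. ?T (\<lambda>y. f y + ?h y) x = ?T f x + ?T ?h x"
      by (rule is_bounded_Lp_extension_add[OF T f h])
    ultimately have "AE x in lebesgue. ?S A f x - ?T f x =
        chirp ?d x * ?T ?h x + (chirp ?d x - 1) * ?T f x"
      by eventually_elim (simp add: algebra_simps)
    then have "(LINT x|lebesgue. norm (?S A f x - ?T f x) powr p) =
        (LINT x|lebesgue. norm (chirp ?d x * ?T ?h x + (chirp ?d x - 1) * ?T f x) powr p)"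
    proof (intro integral_cong_AE)
      assume "AE x in lebesgue. ?S A f x - ?T f x = chirp ?d x * ?T ?h x + (chirp ?d x - 1) * ?T f x"
      then show "AE x in lebesgue. norm (?S A f x - ?T f x) powr p =
          norm (chirp ?d x * ?T ?h x + (chirp ?d x - 1) * ?T f x) powr p"
        by eventually_elim simp
      have [measurable]: "?T ?h \<in> borel_measurable lebesgue" "?T f \<in> borel_measurable lebesgue"
        "?S A f \<in> borel_measurable lebesgue"
        using Tf[OF h] Tf[OF f] Lp_extension_in_Lp_space[OF p0(1) f, of "lc_riesz A l"]
        by (auto simp: Lp_space_def)
      show "(\<lambda>x. norm (chirp ?d x * ?T ?h x + (chirp ?d x - 1) * ?T f x) powr p) \<in> borel_measurable lebesgue"
        "(\<lambda>x. norm (?S A f x - ?T f x) powr p) \<in> borel_measurable lebesgue"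
        by measurable
    qed
    also have "\<dots> \<le> 2 powr p * ((LINT x|lebesgue. norm (chirp ?d x * ?T ?h x) powr p) + ?I (?T f) ?d)"
      by (intro integral_norm_add_powr_le Lp_space_chirp Lp_space_chirp_minus_1 Tf h f p0)
    also have "\<dots> \<le> 2 powr p * (K * ?I f ?a + ?I (?T f) ?d)"
      using K(2)[OF h] by (intro mult_left_mono add_mono) (auto simp: norm_mult)
    finally show ?thesis .
  qed
  have I: "((\<lambda>A. ?I g (s A)) \<longlongrightarrow> 0) sharp_filter" if "(s \<longlongrightarrow> 0) sharp_filter" "g \<in> Lp_space p" for g s
    using isCont_tendsto_compose[OF Lp_chirp_minus_1_isCont[OF p0(1) that(2)] that(1)] by simp
  have "((\<lambda>A. 2 powr p * (K * ?I f (input_chirp A) + ?I (?T f) (- output_chirp A))) \<longlongrightarrow>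
      2 powr p * (K * 0 + 0)) sharp_filter"
    by (intro tendsto_intros I tendsto_input_chirp tendsto_output_chirp f Tf)
  then have lim: "((\<lambda>A. 2 powr p * (K * ?I f (input_chirp A) + ?I (?T f) (- output_chirp A))) \<longlongrightarrow> 0) sharp_filter"
    by simp
  show ?thesis
    by (rule tendsto_sandwich[OF _ _ tendsto_const lim])
      (use bound in \<open>auto intro!: always_eventually\<close>)
qed

section \<open>Pointwise convergence on the Schwartz space\<close>

text \<open>Used with \<open>c = 1\<close> and \<open>c = -1\<close> to write one and the same truncated integral in two ways.\<close>

lemma integral_lborel_affine_unit:
  fixes f :: "'a::euclidean_space \<Rightarrow> 'b::{banach, second_countable_topology}"
  assumes [measurable]: "f \<in> borel_measurable borel" and c: "\<bar>c\<bar> = 1"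
  shows "(LINT y|lborel. f y) = (LINT z|lborel. f (x + c *\<^sub>R z))"
proof -
  have "lborel = density (distr lborel borel (\<lambda>z. x + c *\<^sub>R z)) (\<lambda>_. 1)"
    using lborel_affine[of c x] c by simp
  then have "lborel = distr lborel borel (\<lambda>z. x + c *\<^sub>R z)"
    by (simp add: density_1)
  then have "(LINT y|lborel. f y) = (LINT y|distr lborel borel (\<lambda>z. x + c *\<^sub>R z). f y)"
    by simp
  then show ?thesis
    by (simp add: integral_distr)
qed

definition riesz_kernel :: "2 \<Rightarrow> real^2 \<Rightarrow> real" where
  "riesz_kernel l z = z $ l / norm z ^ 3"

lemma riesz_kernel_measurable [measurable]: "riesz_kernel l \<in> borel_measurable borel"
  unfolding riesz_kernel_def by measurable

lemma riesz_kernel_uminus: "riesz_kernel l (- z) = - riesz_kernel l z"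
  by (simp add: riesz_kernel_def)

lemma abs_riesz_kernel_le: "\<bar>riesz_kernel l z\<bar> \<le> inverse (norm z) ^ 2"
proof (cases "z = 0")
  case False
  have "\<bar>riesz_kernel l z\<bar> = \<bar>z $ l\<bar> * inverse (norm z ^ 3)"
    by (simp add: riesz_kernel_def divide_inverse abs_mult)
  also have "\<dots> \<le> norm z * inverse (norm z ^ 3)"
    by (intro mult_right_mono component_le_norm_cart) auto
  also have "\<dots> = inverse (norm z) ^ 2"
    using False by (simp add: field_simps power3_eq_cube power2_eq_square)
  finally show ?thesis .
qed (simp add: riesz_kernel_def)

definition odd_difference :: "(real^2 \<Rightarrow> complex) \<Rightarrow> real^2 \<Rightarrow> real^2 \<Rightarrow> complex" where
  "odd_difference h x z = h (x - z) - h (x + z)"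

text \<open>The first term controls the region near the singularity, where the difference is Lipschitz; the
  second controls the rest, where the kernel is at most \<open>1\<close>.\<close>

definition riesz_majorant :: "real \<Rightarrow> real \<Rightarrow> real^2 \<Rightarrow> real^2 \<Rightarrow> real" where
  "riesz_majorant C L x z = L * (root_singularity (z $ 1) * root_singularity (z $ 2)) +
     8 * C / weight x * weight z"

lemma integrable_riesz_majorant: "integrable lborel (riesz_majorant C L x)"
proof -
  have "integrable lborel (\<lambda>z::real^2. root_singularity (z $ 1) * root_singularity (z $ 2))"
    by (rule integrable_lborel_prod_real2[OF integrable_root_singularity])
      (simp add: root_singularity_def)
  then show ?thesis
    unfolding riesz_majorant_def using integrable_weight by simp
qed

lemma norm_le_weight_translate:
  assumes C: "0 \<le> C" "\<And>y. norm (h y) \<le> C * weight y"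
  shows "norm (h (x - z)) \<le> 4 * C / weight x * weight z" "norm (h (x + z)) \<le> 4 * C / weight x * weight z"
proof -
  have *: "norm (h (x - z)) \<le> 4 * C / weight x * weight z" for z
  proof -
    have "norm (h (x - z)) \<le> C * (4 / weight x * weight z)"
      using C(2)[of "x - z"] mult_left_mono[OF weight_diff_le C(1)] by (rule order_trans)
    then show ?thesis by (simp add: mult_ac)
  qed
  show "norm (h (x - z)) \<le> 4 * C / weight x * weight z" by (rule *)
  show "norm (h (x + z)) \<le> 4 * C / weight x * weight z"
    using *[of "- z"] by (simp add: weight_uminus)
qed

lemma AE_riesz_kernel_odd_difference_le:
  assumes C: "0 \<le> C" "\<And>y. norm (h y) \<le> C * weight y"
    and L: "0 \<le> L" "\<And>z. norm z \<le> 1 \<Longrightarrow> norm (odd_difference h x z) \<le> L * norm z"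
  shows "AE z in lborel. norm (of_real (riesz_kernel l z) * odd_difference h x z) \<le> riesz_majorant C L x z"
  using AE_coordinate_nonzero[of 1] AE_coordinate_nonzero[of 2]
proof eventually_elim
  case (elim z)
  have nn: "0 \<le> root_singularity t" for t by (simp add: root_singularity_def)
  have K: "norm (of_real (riesz_kernel l z) * odd_difference h x z)
      \<le> inverse (norm z) ^ 2 * norm (odd_difference h x z)"
    by (simp add: norm_mult mult_right_mono abs_riesz_kernel_le)
  show ?case
  proof (cases "norm z \<le> 1")
    case True
    have "z \<noteq> 0" using elim by auto
    have "inverse (norm z) ^ 2 * norm (odd_difference h x z) \<le> inverse (norm z) ^ 2 * (L * norm z)"
      using L(2)[OF True] by (intro mult_left_mono) auto
    also have "\<dots> = L * inverse (norm z)"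
      using \<open>z \<noteq> 0\<close> by (simp add: power2_eq_square)
    also have "\<dots> \<le> L * (root_singularity (z $ 1) * root_singularity (z $ 2))"
      using elim True L(1) by (intro mult_left_mono inverse_norm_le_root_singularity) auto
    also have "\<dots> \<le> riesz_majorant C L x z"
      using C(1) weight_pos[of x] weight_pos[of z] by (simp add: riesz_majorant_def)
    finally show ?thesis using K by linarith
  next
    case False
    have "norm (odd_difference h x z) \<le> norm (h (x - z)) + norm (h (x + z))"
      unfolding odd_difference_def by (rule norm_triangle_ineq4)
    also have "\<dots> \<le> 4 * C / weight x * weight z + 4 * C / weight x * weight z"
      by (intro add_mono norm_le_weight_translate C)
    also have "\<dots> = 8 * C / weight x * weight z"
      by (simp add: field_simps)
    also have "\<dots> \<le> riesz_majorant C L x z"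
      using L(1) nn by (simp add: riesz_majorant_def)
    finally have "norm (odd_difference h x z) \<le> riesz_majorant C L x z" .
    moreover have "inverse (norm z) ^ 2 * norm (odd_difference h x z) \<le> 1 * norm (odd_difference h x z)"
      using False by (intro mult_right_mono power_le_one) (auto simp: inverse_le_1_iff)
    ultimately show ?thesis using K by linarith
  qed
qed

text \<open>The substitutions \<open>y = x - z\<close> and \<open>y = x + z\<close> give the same integral with opposite signs of the
  kernel; the result is their average.\<close>

lemma truncated_riesz_integral_eq:
  assumes [measurable]: "h \<in> borel_measurable borel" and C: "0 \<le> C" "\<And>y. norm (h y) \<le> C * weight y"
    and \<epsilon>: "0 < \<epsilon>"
  shows "(LINT y:{y. \<epsilon> \<le> norm (x - y)}|lebesgue. of_real (riesz_kernel l (x - y)) * h y) =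
    1 / 2 * (LINT z|lborel. (if \<epsilon> \<le> norm z then of_real (riesz_kernel l z) * odd_difference h x z else 0))"
proof -
  define k where "k z = (if \<epsilon> \<le> norm z then complex_of_real (riesz_kernel l z) else 0)" for z
  have k_measurable [measurable]: "k \<in> borel_measurable borel"
    unfolding k_def by measurable
  have int: "integrable lborel (\<lambda>z. k z * g z)"
    if [measurable]: "g \<in> borel_measurable borel" and g: "\<And>z. norm (g z) \<le> 4 * C / weight x * weight z"
    for g :: "real^2 \<Rightarrow> complex"
  proof (rule Bochner_Integration.integrable_bound)
    show "integrable lborel (\<lambda>z. inverse \<epsilon> ^ 2 * (4 * C / weight x * weight z))"
      using integrable_weight by simp
    show "AE z in lborel. norm (k z * g z) \<le> norm (inverse \<epsilon> ^ 2 * (4 * C / weight x * weight z))"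
    proof (rule AE_I2)
      fix z
      have "norm (k z) \<le> inverse \<epsilon> ^ 2"
      proof (cases "\<epsilon> \<le> norm z")
        case True
        have "\<bar>riesz_kernel l z\<bar> \<le> inverse (norm z) ^ 2"
          by (rule abs_riesz_kernel_le)
        also have "\<dots> \<le> inverse \<epsilon> ^ 2"
          using True \<epsilon> by (intro power_mono le_imp_inverse_le) auto
        finally show ?thesis using True by (simp add: k_def)
      qed (simp add: k_def)
      then have "norm (k z * g z) \<le> inverse \<epsilon> ^ 2 * (4 * C / weight x * weight z)"
        unfolding norm_mult by (intro mult_mono g) auto
      also have "\<dots> = norm (inverse \<epsilon> ^ 2 * (4 * C / weight x * weight z))"
        using C(1) weight_pos[of x] weight_pos[of z] by simp
      finally show "norm (k z * g z) \<le> norm (inverse \<epsilon> ^ 2 * (4 * C / weight x * weight z))" .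
    qed
  qed measurable
  have int1: "integrable lborel (\<lambda>z. k z * h (x - z))" and int2: "integrable lborel (\<lambda>z. k z * h (x + z))"
    by (intro int norm_le_weight_translate C; measurable)+
  have meas: "(\<lambda>y. k (x - y) * h y) \<in> borel_measurable borel"
    by measurable
  have "(LINT y:{y. \<epsilon> \<le> norm (x - y)}|lebesgue. of_real (riesz_kernel l (x - y)) * h y) =
      (LINT y|lebesgue. k (x - y) * h y)"
    unfolding set_lebesgue_integral_def by (intro Bochner_Integration.integral_cong) (auto simp: indicator_def k_def)
  also have "\<dots> = (LINT y|lborel. k (x - y) * h y)"
    by (intro integral_completion) (simp only: measurable_lborel2 meas)
  finally have J: "(LINT y:{y. \<epsilon> \<le> norm (x - y)}|lebesgue. of_real (riesz_kernel l (x - y)) * h y) =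
      (LINT y|lborel. k (x - y) * h y)" .
  have J1: "(LINT y|lborel. k (x - y) * h y) = (LINT z|lborel. k z * h (x - z))"
    using integral_lborel_affine_unit[OF meas, of "-1" x] by simp
  have "k (- z) = - k z" for z
    by (simp add: k_def riesz_kernel_uminus)
  then have J2: "(LINT y|lborel. k (x - y) * h y) = - (LINT z|lborel. k z * h (x + z))"
    using integral_lborel_affine_unit[OF meas, of 1 x] by simp
  have "(LINT z|lborel. (if \<epsilon> \<le> norm z then of_real (riesz_kernel l z) * odd_difference h x z else 0)) =
      (LINT z|lborel. k z * h (x - z) - k z * h (x + z))"
    by (intro Bochner_Integration.integral_cong) (simp_all add: k_def odd_difference_def algebra_simps)
  also have "\<dots> = (LINT z|lborel. k z * h (x - z)) - (LINT z|lborel. k z * h (x + z))"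
    by (rule Bochner_Integration.integral_diff[OF int1 int2])
  also have "\<dots> = 2 * (LINT y|lborel. k (x - y) * h y)"
    using J1 J2 by simp
  finally show ?thesis
    unfolding J by simp
qed

text \<open>The integrand on the right is absolutely integrable, so the truncation can be removed by dominated
  convergence; this also shows that the principal value exists.\<close>

lemma riesz_eq_symmetrized_integral:
  assumes h[measurable]: "h \<in> borel_measurable borel" and C: "0 \<le> C" "\<And>y. norm (h y) \<le> C * weight y"
    and L: "0 \<le> L" "\<And>z. norm z \<le> 1 \<Longrightarrow> norm (odd_difference h x z) \<le> L * norm z"
  shows "riesz l h x = of_real riesz_const *
    (1 / 2 * (LINT z|lborel. of_real (riesz_kernel l z) * odd_difference h x z))"
proof -
  let ?F = "\<lambda>\<epsilon> z. (if \<epsilon> \<le> norm z then of_real (riesz_kernel l z) * odd_difference h x z else 0)"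
  have meas [measurable]: "odd_difference h x \<in> borel_measurable borel"
    unfolding odd_difference_def by measurable
  have AE_bound: "AE z in lborel. norm (of_real (riesz_kernel l z) * odd_difference h x z) \<le> riesz_majorant C L x z"
    by (intro AE_riesz_kernel_odd_difference_le C L)
  have "((\<lambda>\<epsilon>. LINT z|lborel. ?F \<epsilon> z) \<longlongrightarrow> (LINT z|lborel. of_real (riesz_kernel l z) * odd_difference h x z)) (at_right 0)"
  proof (rule integral_dominated_convergence_at[OF _ _ integrable_riesz_majorant[of C L x]])
    show "AE z in lborel. ((\<lambda>\<epsilon>. ?F \<epsilon> z) \<longlongrightarrow> of_real (riesz_kernel l z) * odd_difference h x z) (at_right 0)"
    proof (rule AE_I2)
      fix z :: "real^2"
      show "((\<lambda>\<epsilon>. ?F \<epsilon> z) \<longlongrightarrow> of_real (riesz_kernel l z) * odd_difference h x z) (at_right 0)"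
      proof (cases "z = 0")
        case False
        then have "\<forall>\<^sub>F \<epsilon> in at_right 0. \<epsilon> < norm z"
          by (intro eventually_at_right_real[of 0 "norm z", THEN eventually_mono]) auto
        then have "\<forall>\<^sub>F \<epsilon> in at_right 0. of_real (riesz_kernel l z) * odd_difference h x z = ?F \<epsilon> z"
          by eventually_elim simp
        then show ?thesis
          by (rule Lim_transform_eventually[OF tendsto_const])
      next
        case True
        then have "riesz_kernel l z = 0"
          by (simp add: riesz_kernel_def)
        then show ?thesis
          by (simp cong: if_cong)
      qed
    qed
    show "AE z in lborel. norm (?F \<epsilon> z) \<le> riesz_majorant C L x z" for \<epsilon>
      using AE_bound
    proof eventually_elim
      case (elim z)
      have "norm (?F \<epsilon> z) \<le> norm (of_real (riesz_kernel l z) * odd_difference h x z)"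
        by simp
      with elim show ?case by linarith
    qed
  qed measurable
  then have "((\<lambda>\<epsilon>. 1 / 2 * (LINT z|lborel. ?F \<epsilon> z)) \<longlongrightarrow>
      1 / 2 * (LINT z|lborel. of_real (riesz_kernel l z) * odd_difference h x z)) (at_right 0)"
    by (intro tendsto_intros)
  moreover have "\<forall>\<^sub>F \<epsilon> in at_right (0::real). 1 / 2 * (LINT z|lborel. ?F \<epsilon> z) =
      (LINT y:{y. \<epsilon> \<le> norm (x - y)}|lebesgue. of_real (riesz_kernel l (x - y)) * h y)"
    using eventually_at_right_less[of 0]
    by eventually_elim (simp only: truncated_riesz_integral_eq[OF h C])
  ultimately have "((\<lambda>\<epsilon>. LINT y:{y. \<epsilon> \<le> norm (x - y)}|lebesgue. of_real (riesz_kernel l (x - y)) * h y) \<longlongrightarrow>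
      1 / 2 * (LINT z|lborel. of_real (riesz_kernel l z) * odd_difference h x z)) (at_right 0)"
    by (rule Lim_transform_eventually)
  then have "pv_integral x (\<lambda>y. of_real (riesz_kernel l (x - y)) * h y) =
      1 / 2 * (LINT z|lborel. of_real (riesz_kernel l z) * odd_difference h x z)"
    unfolding pv_integral_def by (intro tendsto_Lim) auto
  moreover have "(\<lambda>y. of_real (riesz_kernel l (x - y)) * h y) =
      (\<lambda>y. of_real (x $ l - y $ l) * h y / of_real (norm (x - y) ^ 3))"
    by (simp add: riesz_kernel_def fun_eq_iff)
  ultimately show ?thesis
    unfolding riesz_def by simp
qed

lemma schwartz_space_Lipschitz:
  assumes f: "f \<in> schwartz_space"
  obtains B where "0 \<le> B" "\<And>x y. norm (f x - f y) \<le> B * norm (x - y)"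
proof -
  have "\<exists>C\<ge>0. \<forall>x. norm (partial_deriv j f x) \<le> C" for j
  proof -
    obtain C where "C \<ge> 0" "\<And>x. norm (partial_deriv j f x) \<le> C * weight x"
      using rapidly_decreasing_le_weight[OF schwartz_space_rapidly_decreasing
          [OF schwartz_space_partial_deriv[OF f]]] by blast
    then show ?thesis
      using weight_le_1 by (metis mult_left_le order_trans)
  qed
  then obtain C where C: "\<And>j. 0 \<le> C j" "\<And>j x. norm (partial_deriv j f x) \<le> C j"
    by metis
  let ?f' = "\<lambda>x. frechet_derivative f (at x)"
  have f': "(f has_derivative ?f' x) (at x)" for x
    using schwartz_space_differentiable[OF f] frechet_derivative_works by blast
  have "onorm (?f' x) \<le> C 1 + C 2" for x
  proof (rule onorm_le)
    fix h :: "real^2"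
    have lin: "linear (?f' x)"
      using f' has_derivative_linear by blast
    have "h = h $ 1 *\<^sub>R axis 1 1 + h $ 2 *\<^sub>R axis 2 1"
      by (simp add: vec_eq_iff forall_2 axis_def)
    then have "?f' x h = h $ 1 *\<^sub>R partial_deriv 1 f x + h $ 2 *\<^sub>R partial_deriv 2 f x"
      using linear_add[OF lin] linear_scale[OF lin] unfolding partial_deriv_def by metis
    then have "norm (?f' x h) \<le> \<bar>h $ 1\<bar> * norm (partial_deriv 1 f x) + \<bar>h $ 2\<bar> * norm (partial_deriv 2 f x)"
      by (metis norm_scaleR norm_triangle_ineq)
    also have "\<dots> \<le> norm h * C 1 + norm h * C 2"
      by (intro add_mono mult_mono component_le_norm_cart C) auto
    finally show "norm (?f' x h) \<le> (C 1 + C 2) * norm h"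
      by (simp add: algebra_simps)
  qed
  then have "norm (f x - f y) \<le> (C 1 + C 2) * norm (x - y)" for x y
    by (intro differentiable_bound[OF convex_UNIV f']) auto
  then show ?thesis
    using that[of "C 1 + C 2"] C by simp
qed

text \<open>The difference of the phases at \<open>x - z\<close> and \<open>x + z\<close> is linear in \<open>z\<close>, namely
  \<open>- 4 (s\<^sub>1 x\<^sub>1 z\<^sub>1 + s\<^sub>2 x\<^sub>2 z\<^sub>2)\<close>.\<close>

lemma norm_chirp_diff_le: "norm (chirp s (x - z) - chirp s (x + z)) \<le> 8 * norm s * norm x * norm z"
proof -
  let ?q = "\<lambda>y. \<Sum>k\<in>UNIV. s $ k * (y $ k)\<^sup>2"
  let ?t = "?q (x - z) - ?q (x + z)"
  have "chirp s (x - z) - chirp s (x + z) = chirp s (x + z) * (exp (\<i> * of_real ?t) - 1)"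
    by (simp add: chirp_def right_diff_distrib flip: exp_add)
  then have "norm (chirp s (x - z) - chirp s (x + z)) = 2 * \<bar>sin (?t / 2)\<bar>"
    by (simp only: norm_mult norm_chirp dist_exp_i_1 mult_1)
  also have "\<dots> \<le> \<bar>?t\<bar>"
    using abs_sin_x_le_abs_x[of "?t / 2"] by simp
  also have "?t = - 4 * (s $ 1 * x $ 1 * z $ 1 + s $ 2 * x $ 2 * z $ 2)"
    by (simp add: sum_2 power2_eq_square algebra_simps)
  also have "\<bar>\<dots>\<bar> \<le> 4 * (\<bar>s $ 1\<bar> * \<bar>x $ 1\<bar> * \<bar>z $ 1\<bar> + \<bar>s $ 2\<bar> * \<bar>x $ 2\<bar> * \<bar>z $ 2\<bar>)"
    using abs_triangle_ineq[of "s $ 1 * x $ 1 * z $ 1" "s $ 2 * x $ 2 * z $ 2"]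
    unfolding abs_mult by simp
  also have "\<dots> \<le> 4 * (norm s * norm x * norm z + norm s * norm x * norm z)"
    by (intro mult_left_mono add_mono mult_mono component_le_norm_cart) auto
  finally show ?thesis by simp
qed

text \<open>The decay constant of \<open>chirp s * f\<close> is that of \<open>f\<close>, and its Lipschitz constant at \<open>x\<close> is bounded
  uniformly for \<open>\<bar>s\<bar> \<le> 1\<close>; this gives one majorant for all \<open>s\<close>.\<close>

lemma riesz_chirp_tendsto:
  assumes f: "f \<in> schwartz_space"
  shows "((\<lambda>s. riesz l (\<lambda>y. chirp s y * f y) x) \<longlongrightarrow> riesz l f x) (at 0)"
proof -
  obtain C where C: "0 \<le> C" "\<And>y. norm (f y) \<le> C * weight y"
    using rapidly_decreasing_le_weight[OF schwartz_space_rapidly_decreasing[OF f]] by blast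
  obtain B where B: "0 \<le> B" "\<And>x y. norm (f x - f y) \<le> B * norm (x - y)"
    using schwartz_space_Lipschitz[OF f] by blast
  let ?h = "\<lambda>s y. chirp s y * f y" and ?L = "8 * norm x * C + 2 * B"
  have L0: "0 \<le> ?L" using B C by simp
  have h_meas [measurable]: "?h s \<in> borel_measurable borel" for s
    by (intro schwartz_space_borel schwartz_space_chirp f)
  have hC: "norm (?h s y) \<le> C * weight y" for s y
    using C by (simp add: norm_mult)
  have L: "norm (odd_difference (?h s) x z) \<le> ?L * norm z" if s: "norm s \<le> 1" for s z
  proof -
    have "odd_difference (?h s) x z = (chirp s (x - z) - chirp s (x + z)) * f (x - z) +
        chirp s (x + z) * (f (x - z) - f (x + z))"
      by (simp add: odd_difference_def algebra_simps)
    then have "norm (odd_difference (?h s) x z) \<le> norm (chirp s (x - z) - chirp s (x + z)) * norm (f (x - z)) +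
        norm (f (x - z) - f (x + z))"
      using norm_triangle_ineq[of "(chirp s (x - z) - chirp s (x + z)) * f (x - z)"
          "chirp s (x + z) * (f (x - z) - f (x + z))"] by (simp add: norm_mult)
    also have "\<dots> \<le> (8 * norm x * norm z) * C + B * (2 * norm z)"
    proof (intro add_mono mult_mono)
      have "8 * norm s * norm x * norm z \<le> 8 * 1 * norm x * norm z"
        using s by (intro mult_right_mono mult_left_mono) auto
      then show "norm (chirp s (x - z) - chirp s (x + z)) \<le> 8 * norm x * norm z"
        using norm_chirp_diff_le[of s x z] by simp
      show "norm (f (x - z)) \<le> C"
        using C(2)[of "x - z"] mult_left_le[OF weight_le_1 C(1)] by (rule order_trans)
      have "norm ((x - z) - (x + z)) = norm (2 *\<^sub>R z)"
        by (subst norm_minus_commute) (simp add: scaleR_2)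
      then show "norm (f (x - z) - f (x + z)) \<le> B * (2 * norm z)"
        using B(2)[of "x - z" "x + z"] by simp
    qed auto
    finally show ?thesis by (simp add: algebra_simps)
  qed
  have riesz_eq: "riesz l (?h s) x = of_real riesz_const *
      (1 / 2 * (LINT z|lborel. of_real (riesz_kernel l z) * odd_difference (?h s) x z))" if "norm s \<le> 1" for s
    by (rule riesz_eq_symmetrized_integral[OF h_meas C(1) hC L0 L[OF that]])
  have od_meas [measurable]: "odd_difference (?h s) x \<in> borel_measurable borel" for s
    unfolding odd_difference_def by measurable
  have od_meas0 [measurable]: "odd_difference f x \<in> borel_measurable borel"
    using od_meas[of 0] by simp
  have "((\<lambda>s. LINT z|lborel. of_real (riesz_kernel l z) * odd_difference (?h s) x z) \<longlongrightarrow>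
      (LINT z|lborel. of_real (riesz_kernel l z) * odd_difference f x z)) (at 0 within ball 0 1)"
  proof (rule integral_dominated_convergence_at[OF _ _ integrable_riesz_majorant[of C ?L x]])
    show "AE z in lborel. norm (of_real (riesz_kernel l z) * odd_difference (?h s) x z) \<le> riesz_majorant C ?L x z"
      if "s \<in> ball 0 1" for s
      using that by (intro AE_riesz_kernel_odd_difference_le C(1) hC L0 L) auto
    have "((\<lambda>s. of_real (riesz_kernel l z) * odd_difference (?h s) x z) \<longlongrightarrow>
        of_real (riesz_kernel l z) * (1 * f (x - z) - 1 * f (x + z))) (at 0 within ball 0 1)" for z
      unfolding odd_difference_def by (intro tendsto_intros tendsto_chirp)
    then show "AE z in lborel. ((\<lambda>s. of_real (riesz_kernel l z) * odd_difference (?h s) x z) \<longlongrightarrow>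
        of_real (riesz_kernel l z) * odd_difference f x z) (at 0 within ball 0 1)"
      by (simp add: odd_difference_def)
  qed measurable
  then have "((\<lambda>s. LINT z|lborel. of_real (riesz_kernel l z) * odd_difference (?h s) x z) \<longlongrightarrow>
      (LINT z|lborel. of_real (riesz_kernel l z) * odd_difference f x z)) (at 0)"
    by (simp only: at_within_open[OF centre_in_ball[THEN iffD2, OF zero_less_one] open_ball])
  then have "((\<lambda>s. of_real riesz_const *
      (1 / 2 * (LINT z|lborel. of_real (riesz_kernel l z) * odd_difference (?h s) x z))) \<longlongrightarrow>
      of_real riesz_const * (1 / 2 * (LINT z|lborel. of_real (riesz_kernel l z) * odd_difference f x z))) (at 0)"
    by (intro tendsto_intros)
  moreover have "\<forall>\<^sub>F s in at 0. of_real riesz_const *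
      (1 / 2 * (LINT z|lborel. of_real (riesz_kernel l z) * odd_difference (?h s) x z)) = riesz l (?h s) x"
    unfolding eventually_at by (intro exI[of _ 1]) (auto simp: riesz_eq)
  ultimately have "((\<lambda>s. riesz l (?h s) x) \<longlongrightarrow>
      of_real riesz_const * (1 / 2 * (LINT z|lborel. of_real (riesz_kernel l z) * odd_difference f x z))) (at 0)"
    by (rule Lim_transform_eventually)
  moreover have "riesz l f x = of_real riesz_const *
      (1 / 2 * (LINT z|lborel. of_real (riesz_kernel l z) * odd_difference f x z))"
    using riesz_eq[of 0] by simp
  ultimately show ?thesis
    by (simp only:)
qed

lemma lc_riesz_tendsto:
  assumes f: "f \<in> schwartz_space"
  shows "((\<lambda>A. lc_riesz A l f x) \<longlongrightarrow> riesz l f x) sharp_filter"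
proof -
  have "isCont (\<lambda>s. chirp s x) 0"
    using tendsto_chirp[of x UNIV] by (simp add: isCont_def)
  from isCont_tendsto_compose[OF this tendsto_output_chirp]
  have 1: "((\<lambda>A. chirp (- output_chirp A) x) \<longlongrightarrow> 1) sharp_filter" by simp
  have "isCont (\<lambda>s. riesz l (\<lambda>y. chirp s y * f y) x) 0"
    using riesz_chirp_tendsto[OF f] by (simp add: isCont_def)
  from isCont_tendsto_compose[OF this tendsto_input_chirp]
  have 2: "((\<lambda>A. riesz l (\<lambda>y. chirp (input_chirp A) y * f y) x) \<longlongrightarrow> riesz l f x) sharp_filter" by simp
  show ?thesis
    unfolding lc_riesz_eq_chirp_riesz using tendsto_mult[OF 1 2] by simp
qed

section \<open>Tempered distributions\<close>

text \<open>Expanding \<open>(1 + x\<^sub>1\<^sup>2) (1 + x\<^sub>2\<^sup>2)\<close> gives four monomials; the sum of the corresponding seminorms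
  bounds a function against the weight, and its balls are neighbourhoods of their centres in the Schwartz topology.\<close>

definition decay_seminorm :: "(real^2 \<Rightarrow> complex) \<Rightarrow> real" where
  "decay_seminorm \<phi> = (\<Sum>(m, n)\<in>{0, 2} \<times> {0, 2}. schwartz_seminorm (\<lambda>j. if j = 1 then m else n) [] \<phi>)"

lemma norm_le_decay_seminorm:
  assumes "\<phi> \<in> schwartz_space"
  shows "norm (\<phi> x) \<le> decay_seminorm \<phi> * weight x"
proof -
  have le: "\<bar>x $ 1\<bar> ^ m * \<bar>x $ 2\<bar> ^ n * norm (\<phi> x) \<le> schwartz_seminorm (\<lambda>j. if j = 1 then m else n) [] \<phi>" for m n
  proof -
    have "bdd_above (range (weighted_deriv (\<lambda>j. if j = 1 then m else n) [] \<phi>))"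
      using schwartz_space_rapidly_decreasing[OF assms] by (simp add: rapidly_decreasing_def)
    then have "weighted_deriv (\<lambda>j. if j = 1 then m else n) [] \<phi> x
        \<le> schwartz_seminorm (\<lambda>j. if j = 1 then m else n) [] \<phi>"
      unfolding schwartz_seminorm_def by (rule cSUP_upper[OF UNIV_I])
    then show ?thesis
      by (simp add: weighted_deriv_Nil)
  qed
  have "(1 + (x $ 1)\<^sup>2) * (1 + (x $ 2)\<^sup>2) * norm (\<phi> x) \<le> decay_seminorm \<phi>"
    using le[of 0 0] le[of 0 2] le[of 2 0] le[of 2 2]
    by (simp add: decay_seminorm_def sum.cartesian_product[symmetric] algebra_simps)
  moreover have "0 < (1 + (x $ 1)\<^sup>2) * (1 + (x $ 2)\<^sup>2)"
    by (simp add: add_pos_nonneg)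
  ultimately show ?thesis
    by (simp add: weight_def field_simps)
qed

lemma
  assumes p: "1 \<le> p" and g: "g \<in> Lp_space p" and \<phi>: "\<phi> \<in> schwartz_space"
  shows integrable_Lp_mult_schwartz: "integrable lebesgue (\<lambda>x. g x * \<phi> x)" (is ?A)
    and norm_integral_Lp_mult_schwartz_le: "norm (LINT x|lebesgue. g x * \<phi> x)
      \<le> decay_seminorm \<phi> * (LINT x|lebesgue. norm (g x) * weight x)" (is ?B)
proof -
  have [measurable]: "g \<in> borel_measurable lebesgue" "\<phi> \<in> borel_measurable lebesgue"
    using g schwartz_space_lebesgue[OF \<phi>] by (auto simp: Lp_space_def)
  have int: "integrable lebesgue (\<lambda>x. decay_seminorm \<phi> * (norm (g x) * weight x))"
    using integrable_Lp_mult_weight[OF g p] by simp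
  have le: "norm (g x * \<phi> x) \<le> decay_seminorm \<phi> * (norm (g x) * weight x)" for x
    using mult_left_mono[OF norm_le_decay_seminorm[OF \<phi>, of x] norm_ge_zero[of "g x"]]
    by (simp add: norm_mult mult_ac)
  show ?A
    by (rule Bochner_Integration.integrable_bound[OF int]) (use le in \<open>auto intro: order_trans[OF _ abs_ge_self]\<close>)
  have "norm (LINT x|lebesgue. g x * \<phi> x) \<le> (LINT x|lebesgue. norm (g x * \<phi> x))"
    by (rule integral_norm_bound)
  also have "\<dots> \<le> (LINT x|lebesgue. decay_seminorm \<phi> * (norm (g x) * weight x))"
    using \<open>?A\<close> by (intro integral_mono int le) auto
  finally show ?B by simp
qed

lemma distribution_of_apply:
  "\<phi> \<in> schwartz_space \<Longrightarrow> distribution_of g \<phi> = (LINT x|lebesgue. g x * \<phi> x)"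
  by (simp add: distribution_of_def)

lemma openin_schwartz_seminorm_ball:
  "\<phi> \<in> schwartz_space \<Longrightarrow> 0 < \<epsilon> \<Longrightarrow>
    openin schwartz_topology {\<psi> \<in> schwartz_space. schwartz_seminorm \<alpha> js (\<lambda>x. \<psi> x - \<phi> x) < \<epsilon>}"
  unfolding schwartz_topology_def by (rule topology_generated_by_Basis) blast

lemma schwartz_seminorm_0: "schwartz_seminorm \<alpha> [] (\<lambda>x. 0) = 0"
  by (simp add: schwartz_seminorm_def weighted_deriv_Nil)

lemma topspace_schwartz_topology: "topspace schwartz_topology = schwartz_space"
proof
  show "topspace schwartz_topology \<subseteq> schwartz_space"
    unfolding schwartz_topology_def topology_generated_by_topspace by blast
  show "schwartz_space \<subseteq> topspace schwartz_topology"
  proof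
    fix \<phi> assume \<phi>: "\<phi> \<in> schwartz_space"
    then have "\<phi> \<in> {\<psi> \<in> schwartz_space. schwartz_seminorm (\<lambda>_. 0) [] (\<lambda>x. \<psi> x - \<phi> x) < 1}"
      by (simp add: schwartz_seminorm_0)
    with openin_subset[OF openin_schwartz_seminorm_ball[OF \<phi> zero_less_one]]
    show "\<phi> \<in> topspace schwartz_topology"
      by blast
  qed
qed

lemma openin_decay_seminorm_ball:
  assumes \<phi>: "\<phi> \<in> schwartz_space" and e: "0 < e"
  obtains N where "openin schwartz_topology N" "\<phi> \<in> N"
    "\<And>\<psi>. \<psi> \<in> N \<Longrightarrow> \<psi> \<in> schwartz_space \<and> decay_seminorm (\<lambda>x. \<psi> x - \<phi> x) < e"
proof -
  define S where "S m n = {\<psi> \<in> schwartz_space.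
      schwartz_seminorm (\<lambda>j. if j = 1 then m else n) [] (\<lambda>x. \<psi> x - \<phi> x) < e / 4}" for m n :: nat
  have open_S: "openin schwartz_topology (S m n)" for m n
    unfolding S_def by (rule openin_schwartz_seminorm_ball) (use \<phi> e in auto)
  show ?thesis
  proof
    show "openin schwartz_topology (S 0 0 \<inter> S 0 2 \<inter> (S 2 0 \<inter> S 2 2))"
      by (intro openin_Int open_S)
    show "\<phi> \<in> S 0 0 \<inter> S 0 2 \<inter> (S 2 0 \<inter> S 2 2)"
      using \<phi> e by (simp add: S_def schwartz_seminorm_0)
    show "\<psi> \<in> schwartz_space \<and> decay_seminorm (\<lambda>x. \<psi> x - \<phi> x) < e"
      if "\<psi> \<in> S 0 0 \<inter> S 0 2 \<inter> (S 2 0 \<inter> S 2 2)" for \<psi>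
      using that by (simp add: S_def decay_seminorm_def sum.cartesian_product[symmetric])
  qed
qed

text \<open>Continuity holds because the pairing is bounded by a single continuous seminorm.\<close>

lemma distribution_of_in_tempered_distributions:
  assumes p: "1 \<le> p" and g: "g \<in> Lp_space p"
  shows "distribution_of g \<in> tempered_distributions"
  unfolding tempered_distributions_def
proof (intro CollectI conjI ballI allI)
  show "distribution_of g \<in> extensional schwartz_space"
    by (simp add: distribution_of_def)
  fix \<phi> \<psi> and c :: complex assume \<phi>: "\<phi> \<in> schwartz_space"
  show "distribution_of g (\<lambda>x. c * \<phi> x) = c * distribution_of g \<phi>"
    using \<phi> by (simp add: distribution_of_apply schwartz_space_scale mult.left_commute)
  assume \<psi>: "\<psi> \<in> schwartz_space"
  show "distribution_of g (\<lambda>x. \<phi> x + \<psi> x) = distribution_of g \<phi> + distribution_of g \<psi>"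
    using \<phi> \<psi> integrable_Lp_mult_schwartz[OF p g]
    by (simp add: distribution_of_apply schwartz_space_add distrib_left)
next
  show "continuous_map schwartz_topology euclidean (distribution_of g)"
    unfolding continuous_map_def topspace_schwartz_topology
  proof (intro conjI allI impI)
    fix U :: "complex set" assume "openin euclidean U"
    then have U: "open U" by simp
    show "openin schwartz_topology {\<phi> \<in> schwartz_space. distribution_of g \<phi> \<in> U}"
    proof (subst openin_subopen, intro ballI)
      fix \<phi> assume "\<phi> \<in> {\<phi> \<in> schwartz_space. distribution_of g \<phi> \<in> U}"
      then have \<phi>: "\<phi> \<in> schwartz_space" "distribution_of g \<phi> \<in> U" by auto
      obtain e where e: "0 < e" "ball (distribution_of g \<phi>) e \<subseteq> U"
        using U \<phi>(2) open_contains_ball by blast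
      define K where "K = (LINT x|lebesgue. norm (g x) * weight x)"
      have K: "0 \<le> K"
        unfolding K_def using weight_pos by (intro integral_nonneg_AE) (auto simp: less_imp_le)
      obtain N where N: "openin schwartz_topology N" "\<phi> \<in> N"
        "\<And>\<psi>. \<psi> \<in> N \<Longrightarrow> \<psi> \<in> schwartz_space \<and> decay_seminorm (\<lambda>x. \<psi> x - \<phi> x) < e / (K + 1)"
        using openin_decay_seminorm_ball[OF \<phi>(1), of "e / (K + 1)"] e K by auto
      have "distribution_of g \<psi> \<in> U" if "\<psi> \<in> N" for \<psi>
      proof -
        have \<psi>: "\<psi> \<in> schwartz_space" and lt: "decay_seminorm (\<lambda>x. \<psi> x - \<phi> x) < e / (K + 1)"
          using N(3)[OF that] by auto
        have "distribution_of g \<psi> - distribution_of g \<phi> = (LINT x|lebesgue. g x * (\<psi> x - \<phi> x))"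
          using \<psi> \<phi> integrable_Lp_mult_schwartz[OF p g]
          by (simp add: distribution_of_apply right_diff_distrib)
        then have "norm (distribution_of g \<psi> - distribution_of g \<phi>) \<le> decay_seminorm (\<lambda>x. \<psi> x - \<phi> x) * K"
          unfolding K_def
          using norm_integral_Lp_mult_schwartz_le[OF p g schwartz_space_diff[OF \<psi> \<phi>(1)]] by simp
        also have "\<dots> \<le> e / (K + 1) * K"
          using lt K by (intro mult_right_mono) auto
        also have "\<dots> < e"
          using e K by (simp add: field_simps)
        finally show ?thesis
          using e(2) by (auto simp: dist_norm norm_minus_commute)
      qed
      then show "\<exists>N. openin schwartz_topology N \<and> \<phi> \<in> N \<and>
          N \<subseteq> {\<phi> \<in> schwartz_space. distribution_of g \<phi> \<in> U}"
        using N by blast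
    qed
  qed auto
qed

text \<open>In the weighted bound the parameter is chosen first, to make the constant term small; then the
  remaining term tends to \<open>0\<close>.\<close>

lemma integral_mult_weight_tendsto_0:
  assumes p: "1 \<le> p" and h: "\<And>A. h A \<in> Lp_space p"
    and lim: "((\<lambda>A. LINT x|lebesgue. norm (h A x) powr p) \<longlongrightarrow> 0) F"
  shows "((\<lambda>A. LINT x|lebesgue. norm (h A x) * weight x) \<longlongrightarrow> 0) F"
proof (rule tendstoI)
  fix e :: real assume e: "0 < e"
  define W where "W = (LINT x|lebesgue. weight x)"
  have W: "0 \<le> W"
    unfolding W_def using weight_pos by (intro integral_nonneg_AE) (auto simp: less_imp_le)
  \<comment> \<open>The summand \<open>1\<close> keeps the denominator positive.\<close>
  define \<epsilon> where "\<epsilon> = e / (2 * (W + 1))"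
  have \<epsilon>: "0 < \<epsilon>" "\<epsilon> * W < e / 2"
    using e W by (auto simp: \<epsilon>_def field_simps)
  have "((\<lambda>A. \<epsilon> powr (1 - p) * (LINT x|lebesgue. norm (h A x) powr p)) \<longlongrightarrow> \<epsilon> powr (1 - p) * 0) F"
    by (intro tendsto_intros lim)
  then have "\<forall>\<^sub>F A in F. \<epsilon> powr (1 - p) * (LINT x|lebesgue. norm (h A x) powr p) < e / 2"
    by (rule order_tendstoD) (use e in simp)
  then show "\<forall>\<^sub>F A in F. dist (LINT x|lebesgue. norm (h A x) * weight x) 0 < e"
  proof eventually_elim
    case (elim A)
    have "0 \<le> (LINT x|lebesgue. norm (h A x) * weight x)"
      using weight_pos by (intro integral_nonneg_AE) (auto simp: less_imp_le)
    moreover have "(LINT x|lebesgue. norm (h A x) * weight x) < e"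
      using integral_Lp_mult_weight_le[OF h p \<epsilon>(1), of A] elim \<epsilon>(2) by (simp add: W_def)
    ultimately show ?case by simp
  qed
qed

lemma limitin_tempered_topology_if_Lp_tendsto:
  assumes p: "1 \<le> p" and g: "\<And>A. g A \<in> Lp_space p" and g0: "g0 \<in> Lp_space p"
    and lim: "((\<lambda>A. LINT x|lebesgue. norm (g A x - g0 x) powr p) \<longlongrightarrow> 0) F"
  shows "limitin tempered_topology (\<lambda>A. distribution_of (g A)) (distribution_of g0) F"
  unfolding tempered_topology_def limitin_subtopology limitin_componentwise limitin_canonical_iff
proof (intro conjI ballI)
  show "distribution_of g0 \<in> tempered_distributions"
    "\<forall>\<^sub>F A in F. distribution_of (g A) \<in> tempered_distributions"
    using distribution_of_in_tempered_distributions[OF p] g g0 by auto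
  show "distribution_of g0 \<in> extensional schwartz_space"
    by (simp add: distribution_of_def)
  show "\<forall>\<^sub>F A in F. distribution_of (g A) \<in> topspace (product_topology (\<lambda>_. euclidean) schwartz_space)"
    by (simp add: distribution_of_def PiE_def)
  fix \<phi> assume \<phi>: "\<phi> \<in> schwartz_space"
  let ?h = "\<lambda>A x. g A x - g0 x"
  have p0: "0 \<le> p" using p by simp
  have h: "?h A \<in> Lp_space p" for A
    by (rule Lp_space_diff[OF p0 g g0])
  have "((\<lambda>A. decay_seminorm \<phi> * (LINT x|lebesgue. norm (?h A x) * weight x)) \<longlongrightarrow> decay_seminorm \<phi> * 0) F"
    by (intro tendsto_intros integral_mult_weight_tendsto_0[OF p h lim])
  then have lim0: "((\<lambda>A. decay_seminorm \<phi> * (LINT x|lebesgue. norm (?h A x) * weight x)) \<longlongrightarrow> 0) F"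
    by simp
  have "distribution_of (g A) \<phi> - distribution_of g0 \<phi> = (LINT x|lebesgue. ?h A x * \<phi> x)" for A
    using \<phi> integrable_Lp_mult_schwartz[OF p _ \<phi>] g g0
    by (simp add: distribution_of_apply left_diff_distrib)
  then have "norm (distribution_of (g A) \<phi> - distribution_of g0 \<phi>) \<le>
      decay_seminorm \<phi> * (LINT x|lebesgue. norm (?h A x) * weight x)" for A
    using norm_integral_Lp_mult_schwartz_le[OF p h \<phi>, of A] by simp
  then have "((\<lambda>A. distribution_of (g A) \<phi> - distribution_of g0 \<phi>) \<longlongrightarrow> 0) F"
    by (intro Lim_null_comparison[OF _ lim0] always_eventually) simp
  then show "((\<lambda>A. distribution_of (g A) \<phi>) \<longlongrightarrow> distribution_of g0 \<phi>) F"
    by (rule LIM_zero_cancel)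
qed

text \<open>The sharpness is \<open>b / c\<close>, so \<open>sharpness (A j) * A j $ 2 $ 1\<close> is the entry \<open>b\<close>.\<close>

lemma lc_riesz_eq_sharpness:
  assumes "admissible A"
  shows "lc_riesz A l f x = of_real riesz_const *
          exp (- \<i> * of_real (\<Sum>j\<in>UNIV.
            A j $ 2 $ 2 * (x $ j)\<^sup>2 / (2 * sharpness (A j) * A j $ 2 $ 1))) *
          pv_integral x (\<lambda>y. of_real (x $ l - y $ l) * f y *
            exp (\<i> * of_real (\<Sum>j\<in>UNIV.
              A j $ 1 $ 1 * (y $ j)\<^sup>2 / (2 * sharpness (A j) * A j $ 2 $ 1))) /
            of_real (norm (x - y) ^ 3))"
proof -
  have "2 * sharpness (A j) * A j $ 2 $ 1 = 2 * A j $ 1 $ 2" for j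
    using assms by (simp add: sharpness_def admissible_def)
  then show ?thesis
    by (simp only: lc_riesz_def times_divide_eq_left)
qed

theorem theorem4p2:
  shows
    "(\<forall>A f x l. admissible A \<longrightarrow> f \<in> schwartz_space \<longrightarrow>
        lc_riesz A l f x = of_real riesz_const *
          exp (- \<i> * of_real (\<Sum>j\<in>UNIV.
            A j $ 2 $ 2 * (x $ j)\<^sup>2 / (2 * sharpness (A j) * A j $ 2 $ 1))) *
          pv_integral x (\<lambda>y. of_real (x $ l - y $ l) * f y *
            exp (\<i> * of_real (\<Sum>j\<in>UNIV.
              A j $ 1 $ 1 * (y $ j)\<^sup>2 / (2 * sharpness (A j) * A j $ 2 $ 1))) /
            of_real (norm (x - y) ^ 3)))
     \<and> (\<forall>f\<in>schwartz_space. \<forall>x l.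
        ((\<lambda>A. lc_riesz A l f x) \<longlongrightarrow> riesz l f x) sharp_filter)
     \<and> (\<forall>p>1. \<forall>f\<in>Lp_space p. \<forall>l.
        ((\<lambda>A. Lp_norm p (\<lambda>x. Lp_extension p (lc_riesz A l) f x - Lp_extension p (riesz l) f x))
           \<longlongrightarrow> 0) sharp_filter)
     \<and> (\<forall>p>1. \<forall>f\<in>Lp_space p. \<forall>l.
        limitin tempered_topology
          (\<lambda>A. distribution_of (Lp_extension p (lc_riesz A l) f))
          (distribution_of (Lp_extension p (riesz l) f)) sharp_filter)"
proof (intro conjI allI impI ballI)
  show "lc_riesz A l f x = of_real riesz_const *
          exp (- \<i> * of_real (\<Sum>j\<in>UNIV.
            A j $ 2 $ 2 * (x $ j)\<^sup>2 / (2 * sharpness (A j) * A j $ 2 $ 1))) *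
          pv_integral x (\<lambda>y. of_real (x $ l - y $ l) * f y *
            exp (\<i> * of_real (\<Sum>j\<in>UNIV.
              A j $ 1 $ 1 * (y $ j)\<^sup>2 / (2 * sharpness (A j) * A j $ 2 $ 1))) /
            of_real (norm (x - y) ^ 3))"
    if "admissible A" for A :: "2 \<Rightarrow> real^2^2" and f :: "real^2 \<Rightarrow> complex" and x :: "real^2" and l :: 2
    using that by (rule lc_riesz_eq_sharpness)
  show "((\<lambda>A. lc_riesz A l f x) \<longlongrightarrow> riesz l f x) sharp_filter" if "f \<in> schwartz_space" for f x l
    using that by (rule lc_riesz_tendsto)
next
  fix p :: real and f :: "real^2 \<Rightarrow> complex" and l :: 2
  assume p: "1 < p" and f: "f \<in> Lp_space p"
  have lim: "((\<lambda>A. LINT x|lebesgue. norm (Lp_extension p (lc_riesz A l) f x - Lp_extension p (riesz l) f x) powr p)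
      \<longlongrightarrow> 0) sharp_filter"
    using p f by (intro Lp_extension_lc_riesz_tendsto_powr) auto
  then show "((\<lambda>A. Lp_norm p (\<lambda>x. Lp_extension p (lc_riesz A l) f x - Lp_extension p (riesz l) f x))
      \<longlongrightarrow> 0) sharp_filter"
    unfolding Lp_norm_def using p by (intro tendsto_zero_powrI[where b = "1 / p"]) auto
  show "limitin tempered_topology (\<lambda>A. distribution_of (Lp_extension p (lc_riesz A l) f))
      (distribution_of (Lp_extension p (riesz l) f)) sharp_filter"
    using p f by (intro limitin_tempered_topology_if_Lp_tendsto[of p] lim Lp_extension_in_Lp_space) auto
qed

end
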